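(* Let $B^H$ be a one-dimensional fractional Brownian motion with Hurst parameter $H\in[\tfrac12,1)$ on a complete probability space $(\Omega,\mathcal{F},\mathbb{P})$, let $b\in\mathcal{C}^1_b(\mathbb{R})$ and $y_0\ge0$. Let $(Y,K)$ be the solution to the Skorokhod problem reflected on the horizontal axis $$\forall t\ge0,\qquad Y_t=y_0+\int_0^tb(Y_s)\,ds+K_t+B^H_t,\qquad Y_t\ge0.$$ Then for any $t>0$, the restriction of the law of $Y_t$ to $(0,\infty)$, i.e. the measure $[\mathbf{1}_{\{Y_t>0\}}\mathbb{P}]\circ Y_t^{-1}$, admits a density with respect to the Lebesgue measure.
   Context: $\mathcal{C}^1_b(\mathbb{R})$ is the space of bounded continuously differentiable functions with bounded derivative. The fractional Brownian motion $B^H$ is the (continuous) centred Gaussian process with covariance $\mathbb{E}(B^H_tB^H_s)=\tfrac12(t^{2H}+s^{2H}-|t-s|^{2H})$, $s,t\ge0$. That $(Y,K)$ solves the Skorokhod problem reflected on the horizontal axis means that, almost surely, $Y$ and $K$ are continuous paths satisfying the displayed equation, $Y_t\ge0$ for all $t$, $K$ is non-decreasing (with $K_0=0$), and $\int_0^tY_s\,dK_s=0$ for all $t\ge0$. *)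

theory Defs
  imports "HOL-Probability.Probability"
begin

definition C1_bounded :: "(real \<Rightarrow> real) set" where
  "C1_bounded = {b. (\<forall>x. b differentiable (at x)) \<and> continuous_on UNIV (deriv b) \<and>
     bounded (range b) \<and> bounded (range (deriv b))}"

text \<open>Point masses count as Gaussian: \<^const>\<open>normal_density\<close> only covers positive variance, and
  linear combinations of a Gaussian process may be degenerate (e.g. at time 0).\<close>

definition gaussian_rv :: "'a measure \<Rightarrow> ('a \<Rightarrow> real) \<Rightarrow> bool" where
  "gaussian_rv M X \<longleftrightarrow> X \<in> borel_measurable M \<and>
     (\<exists>\<mu>. distr M borel X = return borel \<mu> \<or>
       (\<exists>\<sigma>>0. distributed M lborel X (\<lambda>x. ennreal (normal_density \<mu> \<sigma> x))))"

text \<open>Processes are indexed by the nonnegative reals; values at negative times are irrelevant.\<close>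

definition gaussian_process :: "'a measure \<Rightarrow> (real \<Rightarrow> 'a \<Rightarrow> real) \<Rightarrow> bool" where
  "gaussian_process M X \<longleftrightarrow>
     (\<forall>T c. finite T \<longrightarrow> T \<subseteq> {0..} \<longrightarrow> gaussian_rv M (\<lambda>\<omega>. \<Sum>t\<in>T. c t * X t \<omega>))"

definition fractional_brownian_motion :: "'a measure \<Rightarrow> real \<Rightarrow> (real \<Rightarrow> 'a \<Rightarrow> real) \<Rightarrow> bool" where
  "fractional_brownian_motion M H B \<longleftrightarrow>
     gaussian_process M B \<and>
     (\<forall>t\<ge>0. (\<integral>\<omega>. B t \<omega> \<partial>M) = 0) \<and>
     (\<forall>t\<ge>0. \<forall>s\<ge>0. (\<integral>\<omega>. B t \<omega> * B s \<omega> \<partial>M) =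
        (t powr (2 * H) + s powr (2 * H) - \<bar>t - s\<bar> powr (2 * H)) / 2) \<and>
     (AE \<omega> in M. continuous_on {0..} (\<lambda>t. B t \<omega>))"

text \<open>For a continuous nondecreasing path k on \<open>[0,\<infinity>)\<close>, the Lebesgue-Stieltjes integral of y against
  dk over \<open>[0,t]\<close>. The path is extended by its value at 0 to negative times, so dk does not charge
  the negative half-line.\<close>

definition stieltjes_integral :: "(real \<Rightarrow> real) \<Rightarrow> (real \<Rightarrow> real) \<Rightarrow> real \<Rightarrow> real" where
  "stieltjes_integral y k t =
     (LINT s:{0..t}|interval_measure (\<lambda>u. k (max 0 u)). y s)"

definition reflected_path ::
  "(real \<Rightarrow> real) \<Rightarrow> real \<Rightarrow> (real \<Rightarrow> real) \<Rightarrow> (real \<Rightarrow> real) \<Rightarrow> (real \<Rightarrow> real) \<Rightarrow> bool" where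
  "reflected_path b y0 w y k \<longleftrightarrow>
     continuous_on {0..} y \<and> continuous_on {0..} k \<and>
     (\<forall>t\<ge>0. y t = y0 + (LINT s:{0..t}|lborel. b (y s)) + k t + w t) \<and>
     (\<forall>t\<ge>0. 0 \<le> y t) \<and>
     k 0 = 0 \<and> mono_on {0..} k \<and>
     (\<forall>t\<ge>0. stieltjes_integral y k t = 0)"

definition solves_skorokhod_problem ::
  "'a measure \<Rightarrow> (real \<Rightarrow> real) \<Rightarrow> real \<Rightarrow> (real \<Rightarrow> 'a \<Rightarrow> real) \<Rightarrow>
   (real \<Rightarrow> 'a \<Rightarrow> real) \<Rightarrow> (real \<Rightarrow> 'a \<Rightarrow> real) \<Rightarrow> bool" where
  "solves_skorokhod_problem M b y0 B Y K \<longleftrightarrow>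
     (\<forall>t\<ge>0. Y t \<in> borel_measurable M) \<and> (\<forall>t\<ge>0. K t \<in> borel_measurable M) \<and>
     (AE \<omega> in M. reflected_path b y0 (\<lambda>t. B t \<omega>) (\<lambda>t. Y t \<omega>) (\<lambda>t. K t \<omega>))"

end

(* The reflected equation is the limit, path by path, of a reflected Euler scheme, so Y_t is a functional
   of the driving path. Write B_s = phi(s) B_t + R_s with phi(s) = Cov(B_s, B_t) / Var(B_t); the Gaussian
   variable B_t is independent of R. For a fixed path R, consider x = B_t as a parameter. As phi is
   strictly increasing on [0, t], raising x by e pushes the solution up; once the solution has left the
   axis for the last time before t, nothing absorbs the push any more, so on {Y_t > 0} the value at t
   grows at least by c e with c > 0 depending on x. Such an expanding map pulls null sets back to null
   sets, and Fubini concludes. Working with the scheme instead of the solution map avoids existence and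
   measurability of solutions driven by the perturbed paths. *)
theory Submission
  imports Defs
begin

text \<open>The law of B is compared with that of R + x * \<phi>, where x is an independent copy of
  \<open>B t\<close>. Both live on the product over \<open>{0..}\<close>, where continuity of paths
  is not an event. The scheme with step t / (n + 1) reads finitely many coordinates, so convergence
  of the scheme to a limit in A is an event there. Continuity returns once the residual path is
  frozen: it makes the growth estimate uniform in n. It can, because raising x keeps the scheme
  above the unperturbed one: only the positivity of the lower scheme has to be controlled, and that
  does not involve e. Independence of R and \<open>B t\<close> enters as an identity between
  characteristic functions of finite linear combinations, which a uniqueness theorem lifts to path
  space.\<close>

section \<open>The reflected Euler scheme\<close>

text \<open>The projection \<open>max 0\<close> stands in for the regulator. Step k reads the path
  only at the grid times k * h and (k + 1) * h, so the scheme can be evaluated on any path, whether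
  or not the equation driven by it has a solution.\<close>

primrec reflected_euler ::
  "(real \<Rightarrow> real) \<Rightarrow> real \<Rightarrow> real \<Rightarrow> (real \<Rightarrow> real) \<Rightarrow> nat \<Rightarrow> real" where
  "reflected_euler b y0 h w 0 = y0"
| "reflected_euler b y0 h w (Suc k) =
     max 0 (reflected_euler b y0 h w k + h * b (reflected_euler b y0 h w k)
            + w (real (Suc k) * h) - w (real k * h))"

lemma C1_bounded_lipschitz:
  assumes "b \<in> C1_bounded"
  obtains L where "0 < L" "L-lipschitz_on UNIV b"
proof -
  from assms have diff: "\<And>x. b differentiable (at x)" and "bounded (range (deriv b))"
    by (auto simp: C1_bounded_def)
  then obtain L where L: "0 < L" "\<And>x. \<bar>deriv b x\<bar> \<le> L"
    by (auto simp: bounded_pos)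
  have "L-lipschitz_on UNIV b"
  proof (rule bounded_derivative_imp_lipschitz)
    show "(b has_derivative (\<lambda>h. deriv b x * h)) (at x within UNIV)" for x
      using diff[of x] by (metis DERIV_deriv_iff_real_differentiable has_field_derivative_def)
    show "onorm (\<lambda>h. deriv b x * h) \<le> L" for x
      using L by (intro onorm_le) (simp add: abs_mult mult_right_mono)
  qed (use L in auto)
  with L show ?thesis by (intro that)
qed

lemma reflected_path_drift_split:
  fixes b y :: "real \<Rightarrow> real"
  assumes b: "continuous_on UNIV b" and y: "continuous_on {0..} y" and uv: "0 \<le> u" "u \<le> v"
  shows "(LINT s:{0..v}|lborel. b (y s)) = (LINT s:{0..u}|lborel. b (y s)) + integral {u..v} (\<lambda>s. b (y s))"
proof -
  have c: "continuous_on {p..q} (\<lambda>s. b (y s))" if "0 \<le> p" for p q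
    by (rule continuous_on_compose2[OF b continuous_on_subset[OF y]]) (use that in auto)
  have eq: "(LINT s:{0..q}|lborel. b (y s)) = integral {0..q} (\<lambda>s. b (y s))" for q
    by (rule set_borel_integral_eq_integral(2)[OF borel_integrable_atLeastAtMost'[OF c]]) simp
  show ?thesis
    unfolding eq
    using Henstock_Kurzweil_Integration.integral_combine[OF uv integrable_continuous_interval[OF c[of 0 v]]]
    by simp
qed

text \<open>The minimum y s0 over [u, v] is positive, and y s0 * (k v - k u) is at most the integral
  of y dk over [0, v], which vanishes.\<close>

lemma reflected_path_regulator_const:
  assumes refl: "reflected_path b y0 w y k" and uv: "0 \<le> u" "u \<le> v"
    and pos: "\<And>s. u \<le> s \<Longrightarrow> s \<le> v \<Longrightarrow> 0 < y s"
  shows "k u = k v"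
proof -
  let ?F = "\<lambda>u. k (max 0 u)"
  let ?\<mu> = "interval_measure ?F"
  from refl have y: "continuous_on {0..} y" and k: "continuous_on {0..} k" "mono_on {0..} k"
    and y0: "\<And>t. 0 \<le> t \<Longrightarrow> 0 \<le> y t" and S: "stieltjes_integral y k v = 0"
    using uv by (auto simp: reflected_path_def)
  have mono: "?F x \<le> ?F z" if "x \<le> z" for x z
    using that by (intro mono_onD[OF k(2)]) auto
  have cont: "continuous_on UNIV ?F"
    by (intro continuous_on_compose2[OF k(1)] continuous_intros) auto
  have fin: "emeasure ?\<mu> {p..q} < \<infinity>" if "p \<le> q" for p q
    using emeasure_interval_measure_Icc[OF that mono cont] by simp
  have "compact {u..v}" "{u..v} \<noteq> {}" using uv by auto
  moreover have "continuous_on {u..v} y" by (rule continuous_on_subset[OF y]) (use uv in auto)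
  ultimately obtain s0 where s0: "s0 \<in> {u..v}" "\<And>s. s \<in> {u..v} \<Longrightarrow> y s0 \<le> y s"
    using continuous_attains_inf[of "{u..v}" y] by auto
  have "bounded (y ` {0..v})"
    by (intro compact_imp_bounded compact_continuous_image continuous_on_subset[OF y]) auto
  then obtain C where "\<forall>x\<in>y ` {0..v}. norm x \<le> C"
    unfolding bounded_iff by blast
  then have C: "\<And>s. s \<in> {0..v} \<Longrightarrow> \<bar>y s\<bar> \<le> C" by auto
  have ym: "(\<lambda>s. indicator {0..v} s *\<^sub>R y s) \<in> borel_measurable borel"
    by (rule borel_measurable_continuous_on_indicator) (auto intro: continuous_on_subset[OF y])
  \<comment> \<open>Integrability matters: the integral of a non-integrable function is zero by
    convention, and \<open>S\<close> would then carry no information.\<close>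
  have int: "set_integrable ?\<mu> {0..v} y"
    unfolding set_integrable_def
    by (rule integrableI_bounded_set[where A="{0..v}" and B=C])
       (use fin[of 0 v] uv C ym in \<open>auto simp: measurable_cong_sets[OF sets_interval_measure HOL.refl]\<close>)
  have int': "set_integrable ?\<mu> {u..v} (\<lambda>s. y s0)"
    unfolding set_integrable_def using fin[of u v] uv by (auto intro!: integrable_scaleR_left)
  have "(LINT s:{u..v}|?\<mu>. y s0) \<le> (LINT s:{0..v}|?\<mu>. y s)"
    unfolding set_lebesgue_integral_def
    by (rule integral_mono[OF int'[unfolded set_integrable_def] int[unfolded set_integrable_def]])
       (use s0 uv y0 in \<open>auto simp: indicator_def\<close>)
  also have "\<dots> = 0" using S by (simp add: stieltjes_integral_def)
  also have "(LINT s:{u..v}|?\<mu>. y s0) = (k v - k u) * y s0"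
  proof -
    have "measure ?\<mu> {u..v} = k v - k u"
      unfolding measure_def using emeasure_interval_measure_Icc[OF uv(2) mono cont] uv mono[of u v] by (simp add: max_def)
    then show ?thesis unfolding set_lebesgue_integral_def by simp
  qed
  finally have "(k v - k u) * y s0 \<le> 0" .
  moreover have "0 < y s0" using s0 pos by auto
  ultimately have "k v \<le> k u" by (simp add: mult_le_0_iff)
  with mono[of u v] uv show ?thesis by (simp add: max_def)
qed

text \<open>An overshoot of the scheme obeys the plain Euler bound, since the regulator only pushes
  y up. An undershoot can exceed that bound only if y meets the axis in [u, v], and then y v is at
  most m. Hence a maximum and not a sum: m without the factor v - u does not add up over the
  steps.\<close>

lemma reflected_path_euler_step:
  assumes refl: "reflected_path b y0 w y k" and L: "L-lipschitz_on UNIV b" and uv: "0 \<le> u" "u \<le> v"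
    and m: "\<And>r s. u \<le> r \<Longrightarrow> r \<le> v \<Longrightarrow> u \<le> s \<Longrightarrow> s \<le> v \<Longrightarrow> \<bar>y r - y s\<bar> \<le> m"
  shows "\<bar>max 0 (z + (v - u) * b z + w v - w u) - y v\<bar>
           \<le> max m ((1 + (v - u) * L) * \<bar>z - y u\<bar> + (v - u) * L * m)"
proof -
  from refl have y: "continuous_on {0..} y" and k: "mono_on {0..} k"
    and nn: "\<And>t. 0 \<le> t \<Longrightarrow> 0 \<le> y t"
    and eq: "\<And>t. 0 \<le> t \<Longrightarrow> y t = y0 + (LINT s:{0..t}|lborel. b (y s)) + k t + w t"
    using uv by (auto simp: reflected_path_def)
  have bc: "continuous_on UNIV b" using L by (rule lipschitz_on_continuous_on)
  have L0: "0 \<le> L" using L by (rule lipschitz_on_nonneg)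
  define I where "I = integral {u..v} (\<lambda>s. b (y s))"
  have step: "y v = y u + I + (k v - k u) + (w v - w u)"
    using eq[of u] eq[of v] uv reflected_path_drift_split[OF bc y uv] by (simp add: I_def)
  have kk: "k u \<le> k v" by (rule mono_onD[OF k]) (use uv in auto)
  have cont: "continuous_on {u..v} (\<lambda>s. b (y s) - b z)"
    by (intro continuous_intros continuous_on_compose2[OF bc continuous_on_subset[OF y]]) (use uv in auto)
  have "norm (integral {u..v} (\<lambda>s. b (y s) - b z)) \<le> (L * (\<bar>z - y u\<bar> + m)) * (v - u)"
  proof (rule integral_bound[OF uv(2) cont])
    fix s assume s: "s \<in> {u..v}"
    have "norm (b (y s) - b z) \<le> L * \<bar>y s - z\<bar>"
      using lipschitz_onD[OF L, of "y s" z] by (simp add: dist_real_def)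
    also have "\<dots> \<le> L * (\<bar>z - y u\<bar> + m)"
      using m[of s u] s uv L0 by (intro mult_left_mono) auto
    finally show "norm (b (y s) - b z) \<le> L * (\<bar>z - y u\<bar> + m)" .
  qed
  moreover have "integral {u..v} (\<lambda>s. b (y s) - b z) = I - (v - u) * b z"
  proof -
    have "(\<lambda>s. b (y s)) integrable_on {u..v}"
      by (intro integrable_continuous_interval continuous_on_compose2[OF bc continuous_on_subset[OF y]]) (use uv in auto)
    then show ?thesis using uv by (subst Henstock_Kurzweil_Integration.integral_diff) (auto simp: I_def)
  qed
  ultimately have Ib: "\<bar>I - (v - u) * b z\<bar> \<le> (v - u) * L * \<bar>z - y u\<bar> + (v - u) * L * m"
    by (simp add: algebra_simps)
  let ?p = "z + (v - u) * b z + w v - w u"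
  have up: "max 0 ?p - y v \<le> \<bar>z - y u\<bar> + (v - u) * L * \<bar>z - y u\<bar> + (v - u) * L * m" (is "_ \<le> ?R")
  proof (cases "?p \<le> 0")
    case True
    have "0 \<le> m" using m[of u u] uv by simp
    then have "0 \<le> ?R" using uv L0 by simp
    then show ?thesis using True nn[of v] uv by simp
  next
    case False
    then show ?thesis using step kk Ib by linarith
  qed
  \<comment> \<open>Either the path touches the axis, and is then small by its modulus of continuity, or it is not
    pushed at all on the interval.\<close>
  have lo: "y v - max 0 ?p \<le> max m ?R"
  proof (cases "\<exists>s\<in>{u..v}. y s \<le> 0")
    case True
    then obtain s where "s \<in> {u..v}" "y s \<le> 0" by auto
    then have "y v \<le> m" using m[of v s] uv unfolding atLeastAtMost_iff by linarith
    then show ?thesis by linarith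
  next
    case False
    then have "k u = k v"
      by (intro reflected_path_regulator_const[OF refl uv]) force
    then have "y v - ?p \<le> ?R" using step Ib by linarith
    then show ?thesis by linarith
  qed
  have "?R = (1 + (v - u) * L) * \<bar>z - y u\<bar> + (v - u) * L * m"
    by (simp add: algebra_simps)
  with up lo show ?thesis by linarith
qed

lemma reflected_euler_error:
  assumes refl: "reflected_path b y0 w y k" and w0: "w 0 = 0"
    and L: "L-lipschitz_on UNIV b" and h: "0 \<le> h" and t: "real n * h \<le> t"
    and m: "\<And>r s. 0 \<le> r \<Longrightarrow> r \<le> t \<Longrightarrow> 0 \<le> s \<Longrightarrow> s \<le> t \<Longrightarrow> \<bar>r - s\<bar> \<le> h \<Longrightarrow> \<bar>y r - y s\<bar> \<le> m"
  shows "\<bar>reflected_euler b y0 h w n - y (real n * h)\<bar> \<le> 2 * m * (1 + h * L) ^ n"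
proof -
  have L0: "0 \<le> L" using L by (rule lipschitz_on_nonneg)
  have t0: "0 \<le> t" using h t by (meson mult_nonneg_nonneg of_nat_0_le_iff order_trans)
  have m0: "0 \<le> m" using m[of 0 0] h t0 by simp
  have hL: "0 \<le> h * L" using h L0 by simp
  \<comment> \<open>Adding m makes the recursion homogeneous: e' <= max m ((1 + h * L) * e + h * L *
    m) becomes e' + m <= max (2 * m) ((1 + h * L) * (e + m)). The constant 2 * m comes from the
    first branch.\<close>
  have "\<bar>reflected_euler b y0 h w i - y (real i * h)\<bar> + m \<le> 2 * m * (1 + h * L) ^ i" if "i \<le> n" for i
    using that
  proof (induction i)
    case 0
    have "(LINT s:{0..0}|lborel. b (y s)) = 0"
      unfolding set_lebesgue_integral_def
      by (rule integral_eq_zero_AE) (use AE_lborel_singleton[of "0::real"] in eventually_elim, auto)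
    then have "y 0 = y0" using refl w0 by (simp add: reflected_path_def)
    then show ?case using m0 by simp
  next
    case (Suc i)
    define e where "e j = \<bar>reflected_euler b y0 h w j - y (real j * h)\<bar>" for j
    have le: "real (Suc i) * h \<le> t"
      using Suc.prems t h by (meson mult_right_mono of_nat_le_iff order_trans)
    have hh: "real (Suc i) * h - real i * h = h" by (simp add: algebra_simps)
    have ih: "0 \<le> real i * h" using h by simp
    have osc: "\<bar>y r - y s\<bar> \<le> m"
      if "real i * h \<le> r" "r \<le> real (Suc i) * h" "real i * h \<le> s" "s \<le> real (Suc i) * h" for r s
      by (rule m) (use that ih le hh in linarith)+
    have "e (Suc i) \<le> max m ((1 + h * L) * e i + h * L * m)"
      unfolding e_def reflected_euler.simps
      by (rule reflected_path_euler_step[OF refl L ih, of "real (Suc i) * h", unfolded hh, OF _ osc])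
         (use h hh in auto)
    then have "e (Suc i) + m \<le> max (2 * m) ((1 + h * L) * (e i + m))"
      by (auto simp: algebra_simps max_def split: if_splits)
    also have "\<dots> \<le> 2 * m * (1 + h * L) ^ Suc i"
    proof (rule max.boundedI)
      have "1 \<le> (1 + h * L) ^ Suc i" by (rule one_le_power) (use hL in simp)
      then show "2 * m \<le> 2 * m * (1 + h * L) ^ Suc i" using m0 by (simp add: mult_le_cancel_left1)
      have "(1 + h * L) * (e i + m) \<le> (1 + h * L) * (2 * m * (1 + h * L) ^ i)"
        using Suc hL by (intro mult_left_mono) (auto simp: e_def)
      then show "(1 + h * L) * (e i + m) \<le> 2 * m * (1 + h * L) ^ Suc i" by (simp add: mult_ac)
    qed
    finally show ?case by (simp add: e_def)
  qed
  from this[of n] m0 show ?thesis by simp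
qed

lemma reflected_euler_tendsto:
  assumes refl: "reflected_path b y0 w y k" and w0: "w 0 = 0"
    and L: "L-lipschitz_on UNIV b" and t: "0 < t"
  shows "(\<lambda>n. reflected_euler b y0 (t / real (Suc n)) w (Suc n)) \<longlonglongrightarrow> y t"
proof (rule LIMSEQ_I)
  fix r :: real assume r: "0 < r"
  have L0: "0 \<le> L" using L by (rule lipschitz_on_nonneg)
  \<comment> \<open>Chosen so that the error bound 2 * m * exp (t * L) equals r / 2.\<close>
  define m where "m = r / (4 * exp (t * L))"
  have m0: "0 < m" using r by (simp add: m_def)
  have "continuous_on {0..t} y"
    using refl by (auto simp: reflected_path_def intro: continuous_on_subset)
  then have "uniformly_continuous_on {0..t} y" by (simp add: compact_uniformly_continuous)
  then obtain d where d: "0 < d"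
    "\<And>p q. p \<in> {0..t} \<Longrightarrow> q \<in> {0..t} \<Longrightarrow> \<bar>p - q\<bar> < d \<Longrightarrow> \<bar>y p - y q\<bar> < m"
    using m0 unfolding uniformly_continuous_on_def dist_real_def by blast
  have "(\<lambda>n. t / real (Suc n)) \<longlonglongrightarrow> 0"
    by (rule LIMSEQ_Suc[OF lim_const_over_n])
  then obtain N where N: "\<And>n. N \<le> n \<Longrightarrow> t / real (Suc n) < d"
    using d(1) t by (fastforce dest!: LIMSEQ_D[of _ _ d])
  show "\<exists>no. \<forall>n\<ge>no. norm (reflected_euler b y0 (t / real (Suc n)) w (Suc n) - y t) < r"
  proof (intro exI allI impI)
    fix n assume n: "N \<le> n"
    define h where "h = t / real (Suc n)"
    have ht: "real (Suc n) * h = t" by (simp add: h_def)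
    have h0: "0 \<le> h" using t by (simp add: h_def)
    have "\<bar>reflected_euler b y0 h w (Suc n) - y (real (Suc n) * h)\<bar> \<le> 2 * m * (1 + h * L) ^ Suc n"
    proof (rule reflected_euler_error[OF refl w0 L h0])
      show "real (Suc n) * h \<le> t" using ht by simp
      show "\<bar>y p - y q\<bar> \<le> m" if "0 \<le> p" "p \<le> t" "0 \<le> q" "q \<le> t" "\<bar>p - q\<bar> \<le> h" for p q
        using d(2)[of p q] that N[OF n] by (auto simp: h_def)
    qed
    also have "\<dots> \<le> 2 * m * exp (t * L)"
    proof (rule mult_left_mono)
      have "(1 + h * L) ^ Suc n \<le> exp (h * L) ^ Suc n"
        by (rule power_mono) (use exp_ge_add_one_self h0 L0 in auto)
      also have "\<dots> = exp (t * L)"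
        unfolding exp_of_nat_mult[symmetric] using ht by (simp add: mult.assoc[symmetric])
      finally show "(1 + h * L) ^ Suc n \<le> exp (t * L)" .
    qed (use m0 in simp)
    also have "\<dots> < r" using r by (simp add: m_def)
    finally show "norm (reflected_euler b y0 (t / real (Suc n)) w (Suc n) - y t) < r"
      using ht unfolding h_def by simp
  qed
qed

section \<open>Dependence on a monotone perturbation of the driving path\<close>

lemma reflected_euler_nonneg: "0 \<le> y0 \<Longrightarrow> 0 \<le> reflected_euler b y0 h w k"
  by (cases k) auto

text \<open>For h * L <= 1 the map taking z to z + h * b z is nondecreasing and shrinks distances by
  a factor no smaller than 1 - h * L. If the unperturbed scheme is positive after the step, its
  projection is inactive, while that of the upper scheme can only help; if it is zero, the order is
  trivial.\<close>

lemma reflected_euler_perturb_step: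
  assumes L: "L-lipschitz_on UNIV b" and h: "0 \<le> h" "h * L \<le> 1"
    and mono: "mono_on {0..} \<phi>" and e: "0 \<le> e"
  shows "reflected_euler b y0 h w k \<le> reflected_euler b y0 h (\<lambda>s. w s + e * \<phi> s) k"
    and "0 < reflected_euler b y0 h w (Suc k) \<Longrightarrow>
      (1 - h * L) * (reflected_euler b y0 h (\<lambda>s. w s + e * \<phi> s) k - reflected_euler b y0 h w k)
        + e * (\<phi> (real (Suc k) * h) - \<phi> (real k * h))
      \<le> reflected_euler b y0 h (\<lambda>s. w s + e * \<phi> s) (Suc k) - reflected_euler b y0 h w (Suc k)"
proof -
  define u where "u = reflected_euler b y0 h w"
  define v where "v = reflected_euler b y0 h (\<lambda>s. w s + e * \<phi> s)"
  define \<Delta> where "\<Delta> j = e * (\<phi> (real (Suc j) * h) - \<phi> (real j * h))" for j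
  have \<Delta>: "0 \<le> \<Delta> j" for j
    unfolding \<Delta>_def using h e
    by (intro mult_nonneg_nonneg) (auto intro!: mono_onD[OF mono] mult_right_mono)
  have step: "(1 - h * L) * (v j - u j) + \<Delta> j \<le> v (Suc j) - u (Suc j)" if "u j \<le> v j" "0 < u (Suc j)" for j
  proof -
    have "\<bar>b (v j) - b (u j)\<bar> \<le> L * (v j - u j)"
      using lipschitz_onD[OF L, of "v j" "u j"] that by (simp add: dist_real_def)
    then have "h * (b (u j) - b (v j)) \<le> h * (L * (v j - u j))"
      using h by (intro mult_left_mono) auto
    then have "(1 - h * L) * (v j - u j) \<le> (v j + h * b (v j)) - (u j + h * b (u j))"
      by (simp add: algebra_simps)
    moreover have "u (Suc j) = u j + h * b (u j) + w (real (Suc j) * h) - w (real j * h)"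
      using that by (auto simp: u_def max_def split: if_splits)
    moreover have "v j + h * b (v j) + w (real (Suc j) * h) - w (real j * h) + \<Delta> j \<le> v (Suc j)"
      unfolding v_def \<Delta>_def by (simp add: algebra_simps)
    ultimately show ?thesis by linarith
  qed
  have le: "u j \<le> v j" for j
  proof (induction j)
    case (Suc j)
    show ?case
    proof (cases "0 < u (Suc j)")
      case True
      have "0 \<le> (1 - h * L) * (v j - u j)" using Suc h by simp
      then show ?thesis using step[OF Suc True] \<Delta>[of j] by linarith
    next
      case False
      moreover have "0 \<le> v (Suc j)" by (simp add: v_def)
      ultimately show ?thesis by linarith
    qed
  qed (simp add: u_def v_def)
  show "reflected_euler b y0 h w k \<le> reflected_euler b y0 h (\<lambda>s. w s + e * \<phi> s) k"
    using le[of k] by (simp add: u_def v_def)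
  show "(1 - h * L) * (reflected_euler b y0 h (\<lambda>s. w s + e * \<phi> s) k - reflected_euler b y0 h w k)
        + e * (\<phi> (real (Suc k) * h) - \<phi> (real k * h))
      \<le> reflected_euler b y0 h (\<lambda>s. w s + e * \<phi> s) (Suc k) - reflected_euler b y0 h w (Suc k)"
    if "0 < reflected_euler b y0 h w (Suc k)"
    using step[OF le[of k]] that unfolding u_def v_def \<Delta>_def by blast
qed

text \<open>After index i each step keeps the gap up to a factor 1 - h * L, and the increments of e
  * \<phi> telescope. The exponent n is cruder than n - i but gives a bound uniform in i.\<close>

lemma reflected_euler_perturb_gap:
  assumes L: "L-lipschitz_on UNIV b" and h: "0 \<le> h" "h * L \<le> 1"
    and mono: "mono_on {0..} \<phi>" and e: "0 \<le> e" and "i \<le> n"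
    and pos: "\<And>j. i < j \<Longrightarrow> j \<le> n \<Longrightarrow> 0 < reflected_euler b y0 h w j"
  shows "(1 - h * L) ^ n * (e * (\<phi> (real n * h) - \<phi> (real i * h)))
    \<le> reflected_euler b y0 h (\<lambda>s. w s + e * \<phi> s) n - reflected_euler b y0 h w n"
  using \<open>i \<le> n\<close> pos
proof (induction n rule: dec_induct)
  case base
  then show ?case using reflected_euler_perturb_step(1)[OF L h mono e] by simp
next
  case (step n)
  define D where "D n = reflected_euler b y0 h (\<lambda>s. w s + e * \<phi> s) n - reflected_euler b y0 h w n" for n
  define q where "q = 1 - h * L"
  have q: "0 \<le> q" "q \<le> 1" using h lipschitz_on_nonneg[OF L] by (auto simp: q_def)
  have m: "0 \<le> e * (\<phi> (real (Suc n) * h) - \<phi> (real n * h))"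
    using h e by (intro mult_nonneg_nonneg) (auto intro!: mono_onD[OF mono] mult_right_mono)
  have "q ^ Suc n * (e * (\<phi> (real (Suc n) * h) - \<phi> (real i * h)))
      = q * (q ^ n * (e * (\<phi> (real n * h) - \<phi> (real i * h))))
        + q ^ Suc n * (e * (\<phi> (real (Suc n) * h) - \<phi> (real n * h)))"
    by (simp add: algebra_simps)
  also have "\<dots> \<le> q * D n + 1 * (e * (\<phi> (real (Suc n) * h) - \<phi> (real n * h)))"
  proof (intro add_mono mult_left_mono mult_right_mono)
    show "q ^ n * (e * (\<phi> (real n * h) - \<phi> (real i * h))) \<le> D n"
      unfolding q_def D_def by (rule step.IH) (use step.prems in auto)
    show "q ^ Suc n \<le> 1" using q by (intro power_le_one)
  qed (use q m in auto)
  also have "\<dots> \<le> D (Suc n)"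
    using reflected_euler_perturb_step(2)[OF L h mono e, of y0 w n] step.prems[of "Suc n"] step.hyps
    unfolding D_def q_def by (simp only: mult_1_left)
  finally show ?case unfolding D_def q_def .
qed

text \<open>While positive, the scheme moves by drift and noise alone, which limits how far it
  climbs from the axis in a short time. Positivity is asked only after i, so that i may be a zero of
  the scheme.\<close>

lemma reflected_euler_increment_le:
  assumes h: "0 \<le> h" and C: "\<And>x. \<bar>b x\<bar> \<le> C" and "i \<le> n"
    and pos: "\<And>j. i < j \<Longrightarrow> j \<le> n \<Longrightarrow> 0 < reflected_euler b y0 h w j"
  shows "reflected_euler b y0 h w n
    \<le> reflected_euler b y0 h w i + C * (real n * h - real i * h) + (w (real n * h) - w (real i * h))"
  using \<open>i \<le> n\<close> pos
proof (induction n rule: dec_induct)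
  case (step n)
  let ?u = "reflected_euler b y0 h w"
  have "?u (Suc n) = ?u n + h * b (?u n) + w (real (Suc n) * h) - w (real n * h)"
    using step.prems[of "Suc n"] step.hyps by (auto simp: max_def split: if_splits)
  moreover have "h * b (?u n) \<le> h * C"
    using h C[of "?u n"] by (intro mult_left_mono) auto
  moreover have "?u n \<le> ?u i + C * (real n * h - real i * h) + (w (real n * h) - w (real i * h))"
    using step by auto
  ultimately show ?case by (simp add: algebra_simps)
qed auto

text \<open>A scheme ending above y / 2 has stayed off the axis during a final period of length d
  that does not depend on n, so the push collected there is at least e * (\<phi> t - \<phi> (t -
  d)), up to the loss factor of the drift.\<close>

lemma reflected_euler_uniform_gap:
  assumes b: "b \<in> C1_bounded" and y0: "0 \<le> y0" and t: "0 < t" and y: "0 < y"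
    and w: "continuous_on {0..t} w"
    and mono: "mono_on {0..} \<phi>" and less: "\<And>s. 0 \<le> s \<Longrightarrow> s < t \<Longrightarrow> \<phi> s < \<phi> t"
  shows "\<exists>c>0. \<forall>\<^sub>F n in sequentially.
    y / 2 < reflected_euler b y0 (t / real (Suc n)) w (Suc n) \<longrightarrow>
    (\<forall>e\<ge>0. c * e \<le> reflected_euler b y0 (t / real (Suc n)) (\<lambda>s. w s + e * \<phi> s) (Suc n)
                     - reflected_euler b y0 (t / real (Suc n)) w (Suc n))"
proof -
  obtain L where L0: "0 < L" and L: "L-lipschitz_on UNIV b"
    using C1_bounded_lipschitz[OF b] .
  have "bounded (range b)" using b by (simp add: C1_bounded_def)
  then obtain C where C0: "0 < C" and C: "\<And>x. \<bar>b x\<bar> \<le> C"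
    by (auto simp: bounded_pos)
  have "uniformly_continuous_on {0..t} w"
    using w by (simp add: compact_uniformly_continuous)
  then obtain d1 where d1: "0 < d1"
    "\<And>p q. p \<in> {0..t} \<Longrightarrow> q \<in> {0..t} \<Longrightarrow> \<bar>p - q\<bar> < d1 \<Longrightarrow> \<bar>w p - w q\<bar> < y / 4"
    using y unfolding uniformly_continuous_on_def dist_real_def
    by (metis zero_less_divide_iff zero_less_numeral)
  \<comment> \<open>Within time d the drift contributes at most y / 4 and the noise less than y / 4,
    too little to climb from the axis above y / 2. The bound d <= t keeps t - d nonnegative.\<close>
  define d where "d = min t (min d1 (y / (4 * C)))"
  have d: "0 < d" "d \<le> t" "d \<le> d1"
    using t d1(1) y C0 by (auto simp: d_def)
  have "C * d \<le> C * (y / (4 * C))"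
    using C0 by (intro mult_left_mono) (auto simp: d_def)
  also have "\<dots> = y / 4" using C0 by simp
  finally have Cd: "C * d \<le> y / 4" .
  define \<delta> where "\<delta> = \<phi> t - \<phi> (t - d)"
  have \<delta>: "0 < \<delta>" using less[of "t - d"] d by (simp add: \<delta>_def)
  \<comment> \<open>Half the limit of (1 - h * L) ^ Suc n for h = t / real (Suc n), so that the
    power eventually exceeds it.\<close>
  define \<kappa> where "\<kappa> = exp (- (t * L)) / 2"
  have \<kappa>: "0 < \<kappa>" by (simp add: \<kappa>_def)
  have "(\<lambda>n. (1 + - (t * L) / real (Suc n)) ^ Suc n) \<longlonglongrightarrow> exp (- (t * L))"
    by (rule LIMSEQ_Suc[OF tendsto_exp_limit_sequentially])
  then have E1: "\<forall>\<^sub>F n in sequentially. \<kappa> < (1 + - (t * L) / real (Suc n)) ^ Suc n"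
    by (rule order_tendstoD) (simp add: \<kappa>_def)
  have "(\<lambda>n. (t * L) / real (Suc n)) \<longlonglongrightarrow> 0"
    by (rule LIMSEQ_Suc[OF lim_const_over_n])
  then have E2: "\<forall>\<^sub>F n in sequentially. (t * L) / real (Suc n) < 1"
    by (rule order_tendstoD) simp
  have "\<forall>\<^sub>F n in sequentially.
    y / 2 < reflected_euler b y0 (t / real (Suc n)) w (Suc n) \<longrightarrow>
    (\<forall>e\<ge>0. \<kappa> * \<delta> * e \<le> reflected_euler b y0 (t / real (Suc n)) (\<lambda>s. w s + e * \<phi> s) (Suc n)
                     - reflected_euler b y0 (t / real (Suc n)) w (Suc n))"
    using E1 E2
  proof eventually_elim
    case (elim n)
    define h where "h = t / real (Suc n)"
    have h: "0 \<le> h" "h * L \<le> 1" using t elim(2) by (auto simp: h_def)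
    have nh: "real (Suc n) * h = t" by (simp add: h_def)
    let ?u = "reflected_euler b y0 h w"
    show ?case unfolding h_def[symmetric]
    proof (intro impI allI)
      fix e :: real assume big: "y / 2 < ?u (Suc n)" and e: "0 \<le> e"
      \<comment> \<open>\<open>i\<close> is the last time on the axis, or the start if there is none.\<close>
      define Z where "Z = insert 0 {k. k \<le> Suc n \<and> ?u k = 0}"
      have fin: "finite Z" by (simp add: Z_def)
      define i where "i = Max Z"
      have iZ: "i \<in> Z" unfolding i_def using fin by (intro Max_in) (auto simp: Z_def)
      then have i: "i \<le> Suc n" by (auto simp: Z_def)
      have pos: "0 < ?u j" if "i < j" "j \<le> Suc n" for j
      proof -
        have "j \<notin> Z" using Max_ge[OF fin, of j] that by (auto simp: i_def)
        then have "?u j \<noteq> 0" using that by (auto simp: Z_def)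
        then show ?thesis using reflected_euler_nonneg[OF y0, of b h w j] by simp
      qed
      have ih: "0 \<le> real i * h" "real i * h \<le> t"
        unfolding nh[symmetric] using h i by (auto intro!: mult_right_mono simp del: of_nat_Suc)
      have "real i * h \<le> t - d"
      proof (rule ccontr)
        assume far: "\<not> real i * h \<le> t - d"
        \<comment> \<open>Time 0 does not lie after t - d, so \<open>i\<close> is a genuine zero of
          the scheme and not the default element of \<open>Z\<close>.\<close>
        then have "i \<noteq> 0" using d by (cases "i = 0") auto
        with iZ have "?u i = 0" by (auto simp: Z_def)
        with reflected_euler_increment_le[OF h(1) C i pos]
        have "?u (Suc n) \<le> C * (t - real i * h) + (w t - w (real i * h))"
          unfolding nh by simp
        moreover have "C * (t - real i * h) \<le> C * d" using far C0 by (intro mult_left_mono) auto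
        moreover have "\<bar>w t - w (real i * h)\<bar> < y / 4"
          using far ih d t by (intro d1(2)) auto
        ultimately show False using big Cd by linarith
      qed
      then have "\<phi> (real i * h) \<le> \<phi> (t - d)"
        using ih d by (intro mono_onD[OF mono]) auto
      then have "\<kappa> * (e * \<delta>) \<le> (1 - h * L) ^ Suc n * (e * (\<phi> (real (Suc n) * h) - \<phi> (real i * h)))"
        unfolding nh using elim(1) e \<delta> \<kappa>
        by (intro mult_mono) (auto simp: \<delta>_def h_def)
      also have "\<dots> \<le> reflected_euler b y0 h (\<lambda>s. w s + e * \<phi> s) (Suc n) - ?u (Suc n)"
        by (rule reflected_euler_perturb_gap[OF L h mono e i pos])
      finally show "\<kappa> * \<delta> * e \<le> reflected_euler b y0 h (\<lambda>s. w s + e * \<phi> s) (Suc n) - ?u (Suc n)"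
        by (simp add: mult_ac)
    qed
  qed
  then show ?thesis using \<kappa> \<delta> by (intro exI[of _ "\<kappa> * \<delta>"]) simp
qed

section \<open>Null sets under expanding maps\<close>

text \<open>Sort the points by a rate 1 / (n + 1) below their constant c. On one class F is
  injective with Lipschitz inverse, so the class is a Lipschitz image of a subset of A. The rate may
  depend on the point because, of two points in the same class, the smaller one supplies the
  estimate.\<close>

lemma negligible_vimage_expanding:
  fixes F :: "real \<Rightarrow> real"
  assumes A: "negligible A"
    and gap: "\<And>x. x \<in> S \<Longrightarrow> F x \<in> A \<Longrightarrow> \<exists>c>0. \<forall>z\<in>S. x < z \<longrightarrow> c * (z - x) \<le> F z - F x"
  shows "negligible {x \<in> S. F x \<in> A}"
proof -
  define T where "T n = {x \<in> S. F x \<in> A \<and> (\<forall>z\<in>S. x < z \<longrightarrow> (z - x) / real (Suc n) \<le> F z - F x)}" for n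
  have "negligible (T n)" for n
  proof -
    have exp: "\<bar>z - x\<bar> \<le> real (Suc n) * \<bar>F z - F x\<bar>" if "x \<in> T n" "z \<in> T n" for x z
    proof -
      have *: "\<bar>z - x\<bar> \<le> real (Suc n) * \<bar>F z - F x\<bar>" if "x \<in> T n" "z \<in> T n" "x < z" for x z
      proof -
        have "(z - x) / real (Suc n) \<le> F z - F x" using that by (auto simp: T_def)
        then have "z - x \<le> real (Suc n) * (F z - F x)"
          by (simp add: pos_divide_le_eq mult.commute)
        also have "\<dots> \<le> real (Suc n) * \<bar>F z - F x\<bar>" by (intro mult_left_mono) auto
        finally show ?thesis using that by simp
      qed
      show ?thesis using *[of x z] *[of z x] that by (cases x z rule: linorder_cases) (auto simp: abs_minus_commute)
    qed
    have inj: "inj_on F (T n)"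
      by (rule inj_onI) (use exp in fastforce)
    have "negligible (inv_into (T n) F ` (F ` T n))"
    proof (rule negligible_locally_Lipschitz_image)
      show "negligible (F ` T n)"
        by (rule negligible_subset[OF A]) (auto simp: T_def)
      fix p assume "p \<in> F ` T n"
      then have "\<forall>q\<in>F ` T n \<inter> UNIV. norm (inv_into (T n) F q - inv_into (T n) F p) \<le> real (Suc n) * norm (q - p)"
        using exp inj by (auto simp del: of_nat_Suc)
      then show "\<exists>U B. open U \<and> p \<in> U \<and>
          (\<forall>q\<in>F ` T n \<inter> U. norm (inv_into (T n) F q - inv_into (T n) F p) \<le> B * norm (q - p))"
        by (intro exI[of _ UNIV] exI[of _ "real (Suc n)"]) simp
    qed simp
    then show ?thesis using inj by simp
  qed
  then have "negligible (\<Union>n. T n)" by (intro negligible_countable_Union) auto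
  moreover have "{x \<in> S. F x \<in> A} \<subseteq> (\<Union>n. T n)"
  proof
    fix x assume x: "x \<in> {x \<in> S. F x \<in> A}"
    then obtain c where c: "0 < c" "\<And>z. z \<in> S \<Longrightarrow> x < z \<Longrightarrow> c * (z - x) \<le> F z - F x"
      using gap by blast
    obtain n where n: "inverse (real (Suc n)) < c" using reals_Archimedean[OF c(1)] by blast
    have "(z - x) / real (Suc n) \<le> F z - F x" if "z \<in> S" "x < z" for z
    proof -
      have "(z - x) / real (Suc n) = inverse (real (Suc n)) * (z - x)" by (simp add: divide_inverse)
      also have "\<dots> \<le> c * (z - x)" using n that by (intro mult_right_mono) auto
      also have "\<dots> \<le> F z - F x" by (rule c(2)[OF that])
      finally show ?thesis .
    qed
    then show "x \<in> (\<Union>n. T n)" using x by (auto simp: T_def)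
  qed
  ultimately show ?thesis by (rule negligible_subset)
qed

lemma reflected_euler_cong:
  assumes "\<And>k. k \<le> n \<Longrightarrow> w (real k * h) = w' (real k * h)"
  shows "reflected_euler b y0 h w n = reflected_euler b y0 h w' n"
  using assms by (induction n) (simp_all del: of_nat_Suc)

text \<open>The gap between the schemes for x and z passes to their limits, so the limit is an
  expanding function of x on the set of convergence. Values in A are positive, as the gap estimate
  requires.\<close>

lemma negligible_reflected_euler_limit:
  assumes b: "b \<in> C1_bounded" and y0: "0 \<le> y0" and t: "0 < t"
    and w: "continuous_on {0..t} w" and \<phi>: "continuous_on {0..t} \<phi>"
    and mono: "mono_on {0..t} \<phi>" and less: "\<And>s. 0 \<le> s \<Longrightarrow> s < t \<Longrightarrow> \<phi> s < \<phi> t"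
    and A: "negligible A" "A \<subseteq> {0<..}"
  shows "negligible {x. convergent (\<lambda>n. reflected_euler b y0 (t / real (Suc n)) (\<lambda>s. w s + x * \<phi> s) (Suc n)) \<and>
    lim (\<lambda>n. reflected_euler b y0 (t / real (Suc n)) (\<lambda>s. w s + x * \<phi> s) (Suc n)) \<in> A}"
proof -
  \<comment> \<open>\<phi> is given as monotone only up to t, while the gap estimate asks for the
    whole half-line. Freezing \<phi> at t leaves the scheme alone, since its grid ends at t.\<close>
  define \<psi> where "\<psi> s = \<phi> (min t s)" for s
  have \<psi>: "continuous_on {0..t} \<psi>" "mono_on {0..} \<psi>"
    by (rule continuous_on_eq[OF \<phi>]) (use t in \<open>auto simp: \<psi>_def min_def intro!: mono_onI mono_onD[OF mono]\<close>)
  have \<psi>_less: "\<psi> s < \<psi> t" if "0 \<le> s" "s < t" for s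
    using less[OF that] that by (simp add: \<psi>_def)
  define G where "G x n = reflected_euler b y0 (t / real (Suc n)) (\<lambda>s. w s + x * \<psi> s) (Suc n)" for x n
  have G: "reflected_euler b y0 (t / real (Suc n)) (\<lambda>s. w s + x * \<phi> s) (Suc n) = G x n" for x n
    unfolding G_def
  proof (rule reflected_euler_cong)
    fix k assume "k \<le> Suc n"
    then have "real k * (t / real (Suc n)) \<le> real (Suc n) * (t / real (Suc n))"
      using t by (intro mult_right_mono) auto
    then show "w (real k * (t / real (Suc n))) + x * \<phi> (real k * (t / real (Suc n)))
        = w (real k * (t / real (Suc n))) + x * \<psi> (real k * (t / real (Suc n)))"
      by (simp add: \<psi>_def min_absorb2 del: of_nat_Suc)
  qed
  define S where "S = {x. convergent (G x)}"
  have "negligible {x \<in> S. lim (G x) \<in> A}"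
  proof (rule negligible_vimage_expanding[OF A(1)])
    fix x assume x: "x \<in> S" "lim (G x) \<in> A"
    define y where "y = lim (G x)"
    have y: "0 < y" using x A by (auto simp: y_def)
    have Gx: "G x \<longlonglongrightarrow> y" using x by (simp add: S_def convergent_LIMSEQ_iff y_def)
    have "continuous_on {0..t} (\<lambda>s. w s + x * \<psi> s)" by (intro continuous_intros w \<psi>(1))
    from reflected_euler_uniform_gap[OF b y0 t y this \<psi>(2) \<psi>_less]
    obtain c where c: "0 < c" and ev: "\<forall>\<^sub>F n in sequentially. y / 2 < G x n \<longrightarrow>
      (\<forall>e\<ge>0. c * e \<le> reflected_euler b y0 (t / real (Suc n)) (\<lambda>s. w s + x * \<psi> s + e * \<psi> s) (Suc n) - G x n)"
      unfolding G_def by blast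
    have big: "\<forall>\<^sub>F n in sequentially. y / 2 < G x n"
      using Gx by (rule order_tendstoD) (use y in simp)
    have "c * (z - x) \<le> lim (G z) - y" if z: "z \<in> S" "x < z" for z
    proof (rule tendsto_lowerbound)
      show "(\<lambda>n. G z n - G x n) \<longlonglongrightarrow> lim (G z) - y"
        by (intro tendsto_diff Gx) (use z in \<open>simp add: S_def convergent_LIMSEQ_iff\<close>)
      show "\<forall>\<^sub>F n in sequentially. c * (z - x) \<le> G z n - G x n"
        using ev big
      proof eventually_elim
        case (elim n)
        have "(\<lambda>s. w s + x * \<psi> s + (z - x) * \<psi> s) = (\<lambda>s. w s + z * \<psi> s)"
          by (simp add: algebra_simps)
        with elim z(2) show ?case unfolding G_def by (auto dest!: spec[of _ "z - x"] simp del: reflected_euler.simps of_nat_Suc)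
      qed
    qed simp
    with c show "\<exists>c>0. \<forall>z\<in>S. x < z \<longrightarrow> c * (z - x) \<le> lim (G z) - lim (G x)"
      unfolding y_def by blast
  qed
  then show ?thesis unfolding G by (simp add: S_def)
qed

section \<open>Characteristic functions of processes\<close>

text \<open>Point masses and normal laws share one formula in which only the second moment appears.
  Frequency 1 suffices, because other frequencies are absorbed into the coefficients of linear
  combinations.\<close>

lemma (in prob_space) centred_gaussian_rv:
  assumes X: "gaussian_rv M X" and mean: "expectation X = 0"
  shows "integrable M (\<lambda>\<omega>. (X \<omega>)\<^sup>2)"
    and "(CLINT \<omega>|M. iexp (X \<omega>)) = exp (- (expectation (\<lambda>\<omega>. (X \<omega>)\<^sup>2) / 2))"
proof -
  have [measurable]: "X \<in> borel_measurable M" using X by (simp add: gaussian_rv_def)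
  consider \<mu> where "distr M borel X = return borel \<mu>"
    | \<mu> \<sigma> where "0 < \<sigma>" "distributed M lborel X (normal_density \<mu> \<sigma>)"
    using X by (auto simp: gaussian_rv_def)
  then have "integrable M (\<lambda>\<omega>. (X \<omega>)\<^sup>2) \<and>
    (CLINT \<omega>|M. iexp (X \<omega>)) = exp (- (expectation (\<lambda>\<omega>. (X \<omega>)\<^sup>2) / 2))"
  proof cases
    case 1
    have "AE x in distr M borel X. x = \<mu>"
      unfolding 1 by (subst AE_return) auto
    then have ae: "AE \<omega> in M. X \<omega> = \<mu>"
      by (rule AE_distrD[rotated]) simp
    then have "expectation X = expectation (\<lambda>_. \<mu>)"
      by (intro integral_cong_AE) auto
    then have ae: "AE \<omega> in M. X \<omega> = 0" using mean ae by (simp add: prob_space)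
    have "integrable M (\<lambda>\<omega>. (X \<omega>)\<^sup>2) \<longleftrightarrow> integrable M (\<lambda>_. 0::real)"
      by (intro integrable_cong_AE) (use ae in auto)
    moreover have "expectation (\<lambda>\<omega>. (X \<omega>)\<^sup>2) = expectation (\<lambda>_. 0)"
      by (intro integral_cong_AE) (use ae in auto)
    moreover have "(CLINT \<omega>|M. iexp (X \<omega>)) = (CLINT \<omega>|M. 1)"
      by (intro integral_cong_AE) (use ae in auto)
    ultimately show ?thesis by (simp add: prob_space)
  next
    case 2
    have \<mu>: "\<mu> = 0" using normal_distributed_expectation[OF 2] mean by simp
    have var: "expectation (\<lambda>\<omega>. (X \<omega>)\<^sup>2) = \<sigma>\<^sup>2"
      using normal_distributed_variance[OF 2] mean by simp
    have "integrable M (\<lambda>\<omega>. (X \<omega>)\<^sup>2)"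
      using integrable_normal_moment[OF 2(1), of \<mu> 2] distributed_integrable[OF 2(2), of "\<lambda>x. x\<^sup>2"]
      by (simp add: \<mu>)
    moreover have "(CLINT \<omega>|M. iexp (X \<omega>)) = exp (- (\<sigma>\<^sup>2 / 2))"
    proof -
      have D: "distributed M lborel (\<lambda>\<omega>. X \<omega> / \<sigma>) std_normal_density"
        using normal_standard_normal_convert[OF 2(1)] 2(2) by (simp add: \<mu>)
      have "(CLINT \<omega>|M. iexp (X \<omega>)) = (CLINT \<omega>|M. iexp (\<sigma> * (X \<omega> / \<sigma>)))"
        using 2(1) by simp
      also have "\<dots> = (CLINT x|distr M lborel (\<lambda>\<omega>. X \<omega> / \<sigma>). iexp (\<sigma> * x))"
        by (subst integral_distr) auto
      also have "\<dots> = char std_normal_distribution \<sigma>"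
        unfolding char_def distributed_distr_eq_density[OF D] ..
      finally show ?thesis by (simp add: char_std_normal_distribution exp_of_real)
    qed
    ultimately show ?thesis by (simp add: var)
  qed
  then show "integrable M (\<lambda>\<omega>. (X \<omega>)\<^sup>2)"
    and "(CLINT \<omega>|M. iexp (X \<omega>)) = exp (- (expectation (\<lambda>\<omega>. (X \<omega>)\<^sup>2) / 2))"
    by auto
qed

text \<open>Dividing by the common total mass m, which is the case u = 0, turns the weights into
  probability densities, to which Levy's theorem applies; for m = 0 both weights vanish almost
  everywhere. The weights will carry events about other coordinates.\<close>

lemma weighted_Levy_uniqueness:
  fixes U X :: "'a \<Rightarrow> real" and V Y :: "'b \<Rightarrow> real"
  assumes M: "prob_space M" and N: "prob_space N"
    and [measurable]: "U \<in> borel_measurable M" "X \<in> borel_measurable M"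
      "V \<in> borel_measurable N" "Y \<in> borel_measurable N" "A \<in> sets borel"
    and U: "\<And>\<omega>. 0 \<le> U \<omega>" "\<And>\<omega>. U \<omega> \<le> C" and V: "\<And>\<omega>. 0 \<le> V \<omega>" "\<And>\<omega>. V \<omega> \<le> C"
    and eq: "\<And>u. (CLINT \<omega>|M. U \<omega> * iexp (u * X \<omega>)) = (CLINT \<omega>|N. V \<omega> * iexp (u * Y \<omega>))"
  shows "(LINT \<omega>|M. U \<omega> * indicator A (X \<omega>)) = (LINT \<omega>|N. V \<omega> * indicator A (Y \<omega>))"
proof -
  interpret M: prob_space M by fact
  interpret N: prob_space N by fact
  have intU: "integrable M U"
    by (rule M.integrable_const_bound[where B=C]) (use U in auto)
  have intV: "integrable N V"
    by (rule N.integrable_const_bound[where B=C]) (use V in auto)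
  define m where "m = integral\<^sup>L M U"
  have "complex_of_real m = complex_of_real (integral\<^sup>L N V)"
    using eq[of 0] by (simp add: m_def)
  then have mV: "integral\<^sup>L N V = m" by (simp only: of_real_eq_iff)
  show ?thesis
  proof (cases "m = 0")
    case True
    have "AE \<omega> in M. U \<omega> = 0"
      using True intU U integral_nonneg_eq_0_iff_AE[OF intU] by (simp add: m_def)
    then have 1: "(LINT \<omega>|M. U \<omega> * indicator A (X \<omega>)) = 0"
      by (intro integral_eq_zero_AE) auto
    have "AE \<omega> in N. V \<omega> = 0"
      using True intV V mV integral_nonneg_eq_0_iff_AE[OF intV] by simp
    then have 2: "(LINT \<omega>|N. V \<omega> * indicator A (Y \<omega>)) = 0"
      by (intro integral_eq_zero_AE) auto
    show ?thesis using 1 2 by simp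
  next
    case False
    have "0 \<le> m" unfolding m_def using U by (intro integral_nonneg_AE) auto
    with False have m: "0 < m" by simp
    have *: "real_distribution (distr (density P (\<lambda>\<omega>. ennreal (W \<omega> / m))) borel Z)
      \<and> (\<forall>u. char (distr (density P (\<lambda>\<omega>. ennreal (W \<omega> / m))) borel Z) u
              = (CLINT \<omega>|P. W \<omega> * iexp (u * Z \<omega>)) / m)
      \<and> measure (distr (density P (\<lambda>\<omega>. ennreal (W \<omega> / m))) borel Z) A = (LINT \<omega>|P. W \<omega> * indicator A (Z \<omega>)) / m"
      if P: "prob_space P" and [measurable]: "W \<in> borel_measurable P" "Z \<in> borel_measurable P"
        and W: "\<And>\<omega>. 0 \<le> W \<omega>" "integrable P W" "integral\<^sup>L P W = m"
      for P :: "'c measure" and W Z :: "'c \<Rightarrow> real"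
    proof (intro conjI allI)
      interpret P: prob_space P by fact
      let ?D = "density P (\<lambda>\<omega>. ennreal (W \<omega> / m))"
      have "prob_space ?D"
        using W m by (intro prob_spaceI) (simp add: emeasure_density nn_integral_eq_integral cong: nn_integral_cong)
      then interpret D: prob_space ?D .
      show "real_distribution (distr ?D borel Z)"
        by (intro real_distribution.intro D.prob_space_distr real_distribution_axioms.intro) auto
      show "char (distr ?D borel Z) u = (CLINT \<omega>|P. W \<omega> * iexp (u * Z \<omega>)) / m" for u
      proof -
        have "char (distr ?D borel Z) u = (CLINT \<omega>|?D. iexp (u * Z \<omega>))"
          unfolding char_def by (subst integral_distr) auto
        also have "\<dots> = (CLINT \<omega>|P. (W \<omega> / m) *\<^sub>R iexp (u * Z \<omega>))"
          by (subst integral_density) (use W m in auto)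
        also have "\<dots> = (CLINT \<omega>|P. W \<omega> * iexp (u * Z \<omega>) / m)"
          by (simp add: scaleR_conv_of_real)
        also have "\<dots> = (CLINT \<omega>|P. W \<omega> * iexp (u * Z \<omega>)) / m"
          by (rule integral_divide_zero)
        finally show ?thesis .
      qed
      show "measure (distr ?D borel Z) A = (LINT \<omega>|P. W \<omega> * indicator A (Z \<omega>)) / m"
      proof -
        have "measure (distr ?D borel Z) A = (LINT x|distr ?D borel Z. indicator A x)"
          by simp
        also have "\<dots> = (LINT \<omega>|?D. indicator A (Z \<omega>))"
          by (subst integral_distr) auto
        also have "\<dots> = (LINT \<omega>|P. (W \<omega> / m) *\<^sub>R indicator A (Z \<omega>))"
          by (subst integral_density) (use W m in auto)
        also have "\<dots> = (LINT \<omega>|P. W \<omega> * indicator A (Z \<omega>) / m)"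
          by simp
        also have "\<dots> = (LINT \<omega>|P. W \<omega> * indicator A (Z \<omega>)) / m"
          by (rule integral_divide_zero)
        finally show ?thesis .
      qed
    qed
    note U' = *[OF M, of U X] and V' = *[OF N, of V Y]
    have "distr (density M (\<lambda>\<omega>. ennreal (U \<omega> / m))) borel X = distr (density N (\<lambda>\<omega>. ennreal (V \<omega> / m))) borel Y"
      by (rule Levy_uniqueness) (use U' V' U V intU intV mV eq in \<open>auto simp: m_def\<close>)
    with U' V' U V intU intV mV m show ?thesis by (simp add: m_def)
  qed
qed

text \<open>Multivariate uniqueness from the one-dimensional theorem: one coordinate at a time moves
  from the exponential to the indicators. Its frequency u is free in the induction hypothesis, and
  the remaining product acts as a weight.\<close>

lemma expectation_indicator_iexp_eqI:
  fixes X :: "'i \<Rightarrow> 'a \<Rightarrow> real" and Y :: "'i \<Rightarrow> 'b \<Rightarrow> real"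
  assumes M: "prob_space M" and N: "prob_space N"
    and X: "\<And>i. i \<in> I \<Longrightarrow> X i \<in> borel_measurable M" and Y: "\<And>i. i \<in> I \<Longrightarrow> Y i \<in> borel_measurable N"
    and A: "\<And>i. i \<in> I \<Longrightarrow> A i \<in> sets borel"
    and eq: "\<And>K c. finite K \<Longrightarrow> K \<subseteq> I \<Longrightarrow>
      (CLINT \<omega>|M. iexp (\<Sum>k\<in>K. c k * X k \<omega>)) = (CLINT \<omega>|N. iexp (\<Sum>k\<in>K. c k * Y k \<omega>))"
    and J: "finite J" "J \<subseteq> I" and K: "finite K" "K \<subseteq> I" "J \<inter> K = {}"
  shows "(CLINT \<omega>|M. complex_of_real (\<Prod>j\<in>J. indicator (A j) (X j \<omega>)) * iexp (\<Sum>k\<in>K. c k * X k \<omega>))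
       = (CLINT \<omega>|N. complex_of_real (\<Prod>j\<in>J. indicator (A j) (Y j \<omega>)) * iexp (\<Sum>k\<in>K. c k * Y k \<omega>))"
  using J K
proof (induction J arbitrary: K c rule: finite_induct)
  case empty
  then show ?case using eq by simp
next
  case (insert p J)
  interpret M: prob_space M by fact
  interpret N: prob_space N by fact
  have p: "p \<in> I" "p \<notin> K" "p \<notin> J" and JI: "J \<subseteq> I" using insert by auto
  define WX :: "'a \<Rightarrow> real" where "WX \<omega> = (\<Prod>j\<in>J. indicator (A j) (X j \<omega>))" for \<omega>
  define WY :: "'b \<Rightarrow> real" where "WY \<omega> = (\<Prod>j\<in>J. indicator (A j) (Y j \<omega>))" for \<omega>
  define SX where "SX \<omega> = (\<Sum>k\<in>K. c k * X k \<omega>)" for \<omega>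
  define SY where "SY \<omega> = (\<Sum>k\<in>K. c k * Y k \<omega>)" for \<omega>
  have [measurable]: "X p \<in> borel_measurable M" "Y p \<in> borel_measurable N" "A p \<in> sets borel"
    using p X Y A by auto
  have [measurable]: "WX \<in> borel_measurable M"
    unfolding WX_def
    by (intro borel_measurable_prod measurable_compose[OF X borel_measurable_indicator]) (use JI A in auto)
  have [measurable]: "WY \<in> borel_measurable N"
    unfolding WY_def
    by (intro borel_measurable_prod measurable_compose[OF Y borel_measurable_indicator]) (use JI A in auto)
  have [measurable]: "SX \<in> borel_measurable M" "SY \<in> borel_measurable N"
    unfolding SX_def SY_def using insert.prems X Y by (auto intro!: borel_measurable_sum borel_measurable_times)
  have WX: "0 \<le> WX \<omega>" "WX \<omega> \<le> 1" for \<omega>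
    unfolding WX_def by (auto intro!: prod_nonneg prod_le_1 simp: indicator_def)
  have WY: "0 \<le> WY \<omega>" "WY \<omega> \<le> 1" for \<omega>
    unfolding WY_def by (auto intro!: prod_nonneg prod_le_1 simp: indicator_def)
  \<comment> \<open>The scale a is used at 0, 1 and -1, the frequencies present in 1 + cos.\<close>
  have base: "(CLINT \<omega>|M. WX \<omega> * iexp (a * SX \<omega> + u * X p \<omega>)) = (CLINT \<omega>|N. WY \<omega> * iexp (a * SY \<omega> + u * Y p \<omega>))" for a u
  proof -
    have "(\<Sum>k\<in>insert p K. (if k = p then u else a * c k) * Z k) = a * (\<Sum>k\<in>K. c k * Z k) + u * Z p" for Z :: "'i \<Rightarrow> real"
    proof -
      have "(\<Sum>k\<in>K. (if k = p then u else a * c k) * Z k) = (\<Sum>k\<in>K. a * (c k * Z k))"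
        using p by (intro sum.cong) auto
      then show ?thesis using p insert.prems by (simp add: sum_distrib_left)
    qed
    then show ?thesis
      using insert.IH[of "insert p K" "\<lambda>k. if k = p then u else a * c k"] insert.prems insert.hyps
      by (simp add: WX_def WY_def SX_def SY_def)
  qed
  have one: "(LINT \<omega>|M. WX \<omega> * indicator (A p) (X p \<omega>)) = (LINT \<omega>|N. WY \<omega> * indicator (A p) (Y p \<omega>))"
    by (rule weighted_Levy_uniqueness[OF M N, where C=1]) (use WX WY base[of 0] in auto)
  \<comment> \<open>The weight \<open>iexp s\<close> is traded for \<open>1 + cos (s + \<theta>)\<close>, which is nonnegative and hence gives a
    measure to which the one-dimensional uniqueness theorem applies.\<close>
  have cosx: "complex_of_real (w * (1 + cos (s + \<theta>))) * iexp (u * x)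
      = w * iexp (0 * s + u * x) + (iexp \<theta> / 2) * (w * iexp (1 * s + u * x))
        + (iexp (- \<theta>) / 2) * (w * iexp ((-1) * s + u * x))" for w s \<theta> u x :: real
  proof -
    have c: "complex_of_real (cos (s + \<theta>)) = (iexp s * iexp \<theta> + iexp (- s) * iexp (- \<theta>)) / 2"
      by (simp add: cos_of_real[symmetric] cos_exp_eq exp_add[symmetric] algebra_simps)
    have e: "iexp (r + q) = iexp r * iexp q" for r q
      by (simp add: exp_add[symmetric] algebra_simps)
    show ?thesis
      unfolding e[of "0 * s"] e[of "1 * s"] e[of "(-1) * s"] of_real_mult[of w] of_real_add[of 1] c
      by (simp add: field_simps)
  qed
  have bnd: "integrable M (\<lambda>\<omega>. WX \<omega> * iexp (a * SX \<omega> + u * X p \<omega>))"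
            "integrable N (\<lambda>\<omega>. WY \<omega> * iexp (a * SY \<omega> + u * Y p \<omega>))" for a u
    by (rule M.integrable_const_bound[where B=1], use WX in \<open>auto simp: norm_mult\<close>)
       (rule N.integrable_const_bound[where B=1], use WY in \<open>auto simp: norm_mult\<close>)
  have cosE: "(LINT \<omega>|M. (WX \<omega> * (1 + cos (SX \<omega> + \<theta>))) * indicator (A p) (X p \<omega>))
           = (LINT \<omega>|N. (WY \<omega> * (1 + cos (SY \<omega> + \<theta>))) * indicator (A p) (Y p \<omega>))" for \<theta>
  proof (rule weighted_Levy_uniqueness[OF M N, where C=2])
    have c: "0 \<le> 1 + cos x \<and> 1 + cos x \<le> 2" for x :: real
      using cos_ge_minus_one[of x] cos_le_one[of x] by (intro conjI; linarith)
    show "0 \<le> WX \<omega> * (1 + cos (SX \<omega> + \<theta>))" "WX \<omega> * (1 + cos (SX \<omega> + \<theta>)) \<le> 2" for \<omega>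
      using c WX mult_mono[of "WX \<omega>" 1 "1 + cos (SX \<omega> + \<theta>)" 2] by auto
    show "0 \<le> WY \<omega> * (1 + cos (SY \<omega> + \<theta>))" "WY \<omega> * (1 + cos (SY \<omega> + \<theta>)) \<le> 2" for \<omega>
      using c WY mult_mono[of "WY \<omega>" 1 "1 + cos (SY \<omega> + \<theta>)" 2] by auto
    show "(CLINT \<omega>|M. complex_of_real (WX \<omega> * (1 + cos (SX \<omega> + \<theta>))) * iexp (u * X p \<omega>))
        = (CLINT \<omega>|N. complex_of_real (WY \<omega> * (1 + cos (SY \<omega> + \<theta>))) * iexp (u * Y p \<omega>))" for u
      unfolding cosx
      by (simp only: Bochner_Integration.integral_add Bochner_Integration.integrable_add
            integrable_mult_right integral_mult_right_zero bnd base)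
  qed (auto intro: WX WY)
  have ind: "integrable M (\<lambda>\<omega>. WX \<omega> * indicator (A p) (X p \<omega>))"
    "integrable M (\<lambda>\<omega>. WX \<omega> * cos (SX \<omega> + \<theta>) * indicator (A p) (X p \<omega>))"
    "integrable N (\<lambda>\<omega>. WY \<omega> * indicator (A p) (Y p \<omega>))"
    "integrable N (\<lambda>\<omega>. WY \<omega> * cos (SY \<omega> + \<theta>) * indicator (A p) (Y p \<omega>))" for \<theta>
    using WX WY
    by (auto intro!: M.integrable_const_bound[where B=1] N.integrable_const_bound[where B=1]
             simp: abs_mult indicator_def mult_le_one)
  \<comment> \<open>Subtracting \<open>one\<close> removes the constant in 1 + cos. Then \<theta> =
    0 and \<theta> = - pi / 2 yield the real and imaginary parts of \<open>iexp\<close>.\<close>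
  have cosE': "(LINT \<omega>|M. WX \<omega> * cos (SX \<omega> + \<theta>) * indicator (A p) (X p \<omega>))
           = (LINT \<omega>|N. WY \<omega> * cos (SY \<omega> + \<theta>) * indicator (A p) (Y p \<omega>))" for \<theta>
    using cosE[of \<theta>] one ind(1,3) ind(2,4)[of \<theta>] by (simp add: ring_distribs)
  have split: "complex_of_real (\<Prod>j\<in>insert p J. indicator (A j) (Z j)) * iexp s =
      complex_of_real ((\<Prod>j\<in>J. indicator (A j) (Z j)) * cos (s + 0) * indicator (A p) (Z p))
      + \<i> * complex_of_real ((\<Prod>j\<in>J. indicator (A j) (Z j)) * cos (s + - (pi/2)) * indicator (A p) (Z p))"
    for Z :: "'i \<Rightarrow> real" and s :: real
  proof -
    have "iexp s = complex_of_real (cos s) + \<i> * complex_of_real (sin s)"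
      by (simp add: cis_conv_exp[symmetric] complex_eq_iff)
    moreover have "cos (s + - (pi/2)) = sin s" by (simp add: cos_diff)
    ultimately show ?thesis
      using insert.hyps by (simp add: indicator_def of_real_prod algebra_simps if_distrib cong: if_cong)
  qed
  show ?case
    unfolding split WX_def[symmetric] WY_def[symmetric] SX_def[symmetric] SY_def[symmetric]
    by (simp only: Bochner_Integration.integral_add integrable_mult_right integral_mult_right_zero
          integrable_of_real integral_complex_of_real ind cosE')
qed

text \<open>Finite-dimensional cylinders determine a finite measure on the product, and their
  probabilities are the case \<open>K = {}\<close> of
  \<open>expectation_indicator_iexp_eqI\<close>.\<close>

lemma distr_PiM_eqI_char:
  fixes X :: "'i \<Rightarrow> 'a \<Rightarrow> real" and Y :: "'i \<Rightarrow> 'b \<Rightarrow> real"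
  assumes M: "prob_space M" and N: "prob_space N"
    and X: "\<And>i. i \<in> I \<Longrightarrow> X i \<in> borel_measurable M" and Y: "\<And>i. i \<in> I \<Longrightarrow> Y i \<in> borel_measurable N"
    and eq: "\<And>K c. finite K \<Longrightarrow> K \<subseteq> I \<Longrightarrow>
      (CLINT \<omega>|M. iexp (\<Sum>k\<in>K. c k * X k \<omega>)) = (CLINT \<omega>|N. iexp (\<Sum>k\<in>K. c k * Y k \<omega>))"
  shows "distr M (\<Pi>\<^sub>M i\<in>I. borel) (\<lambda>\<omega>. \<lambda>i\<in>I. X i \<omega>) = distr N (\<Pi>\<^sub>M i\<in>I. borel) (\<lambda>\<omega>. \<lambda>i\<in>I. Y i \<omega>)"
proof (rule measure_eqI_PiM_infinite)
  interpret M: prob_space M by fact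
  have XM: "(\<lambda>\<omega>. \<lambda>i\<in>I. X i \<omega>) \<in> measurable M (\<Pi>\<^sub>M i\<in>I. borel)"
    by (intro measurable_restrict X)
  show "finite_measure (distr M (\<Pi>\<^sub>M i\<in>I. borel) (\<lambda>\<omega>. \<lambda>i\<in>I. X i \<omega>))"
    using M.prob_space_distr[OF XM] by (simp add: prob_space_def)
  fix A :: "'i \<Rightarrow> real set" and J assume J: "finite J" "J \<subseteq> I" and A: "\<And>i. i \<in> J \<Longrightarrow> A i \<in> sets borel"
  let ?E = "prod_emb I (\<lambda>i. borel) J (Pi\<^sub>E J A)"
  have E: "?E \<in> sets (\<Pi>\<^sub>M i\<in>I. borel)" using A by (intro sets_PiM_I J) auto
  define A' where "A' i = (if i \<in> J then A i else UNIV)" for i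
  have A': "\<And>i. i \<in> I \<Longrightarrow> A' i \<in> sets borel" using A by (auto simp: A'_def)
  have *: "emeasure (distr P (\<Pi>\<^sub>M i\<in>I. borel) (\<lambda>\<omega>. \<lambda>i\<in>I. Z i \<omega>)) ?E
      = ennreal (LINT \<omega>|P. (\<Prod>j\<in>J. indicator (A' j) (Z j \<omega>)))"
    if P: "prob_space P" and Z: "\<And>i. i \<in> I \<Longrightarrow> Z i \<in> borel_measurable P" for P :: "'c measure" and Z
  proof -
    interpret P: prob_space P by fact
    have ZP: "(\<lambda>\<omega>. \<lambda>i\<in>I. Z i \<omega>) \<in> measurable P (\<Pi>\<^sub>M i\<in>I. borel)"
      by (intro measurable_restrict Z)
    let ?S = "(\<lambda>\<omega>. \<lambda>i\<in>I. Z i \<omega>) -` ?E \<inter> space P"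
    have "emeasure (distr P (\<Pi>\<^sub>M i\<in>I. borel) (\<lambda>\<omega>. \<lambda>i\<in>I. Z i \<omega>)) ?E = emeasure P ?S"
      by (rule emeasure_distr[OF ZP E])
    also have "\<dots> = ennreal (LINT \<omega>|P. indicator ?S \<omega>)"
      by (simp add: P.emeasure_eq_measure)
    also have "(LINT \<omega>|P. indicator ?S \<omega>) = (LINT \<omega>|P. (\<Prod>j\<in>J. indicator (A' j) (Z j \<omega>) :: real))"
    proof (rule Bochner_Integration.integral_cong[OF refl])
      fix \<omega> assume \<omega>: "\<omega> \<in> space P"
      have "\<omega> \<in> ?S \<longleftrightarrow> (\<forall>j\<in>J. Z j \<omega> \<in> A' j)"
        using J \<omega> by (auto simp: prod_emb_def PiE_iff A'_def subset_iff)
      then show "indicator ?S \<omega> = (\<Prod>j\<in>J. indicator (A' j) (Z j \<omega>) :: real)"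
        using J by (auto simp: indicator_def intro!: prod_zero[symmetric])
    qed
    finally show ?thesis .
  qed
  have "complex_of_real (LINT \<omega>|M. (\<Prod>j\<in>J. indicator (A' j) (X j \<omega>)))
      = complex_of_real (LINT \<omega>|N. (\<Prod>j\<in>J. indicator (A' j) (Y j \<omega>)))"
    using expectation_indicator_iexp_eqI[where K="{}", OF M N X Y A' eq J]
    by (simp del: of_real_prod)
  then show "emeasure (distr M (\<Pi>\<^sub>M i\<in>I. borel) (\<lambda>\<omega>. \<lambda>i\<in>I. X i \<omega>)) ?E
           = emeasure (distr N (\<Pi>\<^sub>M i\<in>I. borel) (\<lambda>\<omega>. \<lambda>i\<in>I. Y i \<omega>)) ?E"
    by (simp only: *[OF M X] *[OF N Y] of_real_eq_iff)
qed simp_all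

section \<open>Centred Gaussian processes and resampling of one coordinate\<close>

lemma (in prob_space) centred_gaussian_process_integrable:
  assumes B: "gaussian_process M B" and mean: "\<And>s. 0 \<le> s \<Longrightarrow> expectation (B s) = 0"
  shows "0 \<le> s \<Longrightarrow> B s \<in> borel_measurable M"
    and "0 \<le> s \<Longrightarrow> integrable M (B s)"
    and "0 \<le> s \<Longrightarrow> 0 \<le> r \<Longrightarrow> integrable M (\<lambda>\<omega>. B s \<omega> * B r \<omega>)"
proof -
  have g: "gaussian_rv M (B s)" if "0 \<le> s" for s
    using B[unfolded gaussian_process_def, rule_format, of "{s}" "\<lambda>_. 1"] that by simp
  show m: "B s \<in> borel_measurable M" if "0 \<le> s" for s
    using g[OF that] by (simp add: gaussian_rv_def)
  have sq: "integrable M (\<lambda>\<omega>. (B s \<omega>)\<^sup>2)" if "0 \<le> s" for s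
    using centred_gaussian_rv(1)[OF g mean] that by simp
  show "integrable M (B s)" if "0 \<le> s" for s
    by (rule square_integrable_imp_integrable[OF m sq]) (use that in auto)
  show "integrable M (\<lambda>\<omega>. B s \<omega> * B r \<omega>)" if "0 \<le> s" "0 \<le> r" for s r
  proof (rule Bochner_Integration.integrable_bound)
    show "integrable M (\<lambda>\<omega>. (B s \<omega>)\<^sup>2 + (B r \<omega>)\<^sup>2)" using sq that by simp
    show "(\<lambda>\<omega>. B s \<omega> * B r \<omega>) \<in> borel_measurable M" using m that by simp
    have "\<bar>x * y\<bar> \<le> x\<^sup>2 + y\<^sup>2" for x y :: real
      using sum_squares_bound[of "\<bar>x\<bar>" "\<bar>y\<bar>"] mult_nonneg_nonneg[of "\<bar>x\<bar>" "\<bar>y\<bar>"]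
      unfolding abs_mult power2_abs by linarith
    then show "AE \<omega> in M. norm (B s \<omega> * B r \<omega>) \<le> norm ((B s \<omega>)\<^sup>2 + (B r \<omega>)\<^sup>2)"
      by simp
  qed
qed

lemma (in prob_space) centred_gaussian_process_char:
  assumes B: "gaussian_process M B" and mean: "\<And>s. 0 \<le> s \<Longrightarrow> expectation (B s) = 0"
    and T: "finite T" "T \<subseteq> {0..}"
  shows "integrable M (\<lambda>\<omega>. (\<Sum>s\<in>T. c s * B s \<omega>)\<^sup>2)"
    and "(CLINT \<omega>|M. iexp (\<Sum>s\<in>T. c s * B s \<omega>)) = exp (- (expectation (\<lambda>\<omega>. (\<Sum>s\<in>T. c s * B s \<omega>)\<^sup>2) / 2))"
proof -
  have g: "gaussian_rv M (\<lambda>\<omega>. \<Sum>s\<in>T. c s * B s \<omega>)"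
    using B T by (simp add: gaussian_process_def)
  have "expectation (\<lambda>\<omega>. \<Sum>s\<in>T. c s * B s \<omega>) = (\<Sum>s\<in>T. c s * expectation (B s))"
    by (subst Bochner_Integration.integral_sum)
       (use T centred_gaussian_process_integrable(2)[OF B mean] in auto)
  also have "\<dots> = 0" by (rule sum.neutral) (use T mean in auto)
  finally have z: "expectation (\<lambda>\<omega>. \<Sum>s\<in>T. c s * B s \<omega>) = 0" .
  show "integrable M (\<lambda>\<omega>. (\<Sum>s\<in>T. c s * B s \<omega>)\<^sup>2)"
    "(CLINT \<omega>|M. iexp (\<Sum>s\<in>T. c s * B s \<omega>)) = exp (- (expectation (\<lambda>\<omega>. (\<Sum>s\<in>T. c s * B s \<omega>)\<^sup>2) / 2))"
    by (rule centred_gaussian_rv[OF g z])+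
qed

text \<open>The residual of the projection onto \<open>B t\<close> is independent of \<open>B t\<close>, so the law is unchanged when
  \<open>B t\<close> is replaced by an independent copy.\<close>

lemma (in prob_space) gaussian_process_resample:
  assumes B: "gaussian_process M B" and mean: "\<And>s. 0 \<le> s \<Longrightarrow> expectation (B s) = 0"
    and t: "0 \<le> t" and var: "expectation (\<lambda>\<omega>. B t \<omega> * B t \<omega>) \<noteq> 0"
    and \<phi>: "\<And>s. 0 \<le> s \<Longrightarrow> \<phi> s = expectation (\<lambda>\<omega>. B s \<omega> * B t \<omega>) / expectation (\<lambda>\<omega>. B t \<omega> * B t \<omega>)"
  shows "distr M (\<Pi>\<^sub>M s\<in>{0..}. borel) (\<lambda>\<omega>. \<lambda>s\<in>{0..}. B s \<omega>)
    = distr (M \<Otimes>\<^sub>M M) (\<Pi>\<^sub>M s\<in>{0..}. borel) (\<lambda>p. \<lambda>s\<in>{0..}. B s (fst p) + (B t (snd p) - B t (fst p)) * \<phi> s)"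
proof (rule distr_PiM_eqI_char)
  interpret MM: pair_prob_space M M ..
  note gi = centred_gaussian_process_integrable[OF B mean]
  note gp = centred_gaussian_process_char[OF B mean]
  have [measurable]: "B s \<in> borel_measurable M" if "0 \<le> s" for s
    using gi(1) that by simp
  show "prob_space M" by unfold_locales
  show "prob_space (M \<Otimes>\<^sub>M M)" by unfold_locales
  show "B s \<in> borel_measurable M" if "s \<in> {0..}" for s using that by simp
  show "(\<lambda>p. B s (fst p) + (B t (snd p) - B t (fst p)) * \<phi> s) \<in> borel_measurable (M \<Otimes>\<^sub>M M)" if "s \<in> {0..}" for s
    using that t
    by (intro borel_measurable_add borel_measurable_diff borel_measurable_times borel_measurable_const
          measurable_compose[OF measurable_fst] measurable_compose[OF measurable_snd]) auto
  fix K :: "real set" and c :: "real \<Rightarrow> real" assume K: "finite K" "K \<subseteq> {0..}"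
  define S where "S \<omega> = (\<Sum>k\<in>K. c k * B k \<omega>)" for \<omega>
  define v where "v = expectation (\<lambda>\<omega>. B t \<omega> * B t \<omega>)"
  \<comment> \<open>With this a the residual S - a * B t is uncorrelated with B t, because \<phi> k
    * v is the covariance of B k and B t.\<close>
  define a where "a = (\<Sum>k\<in>K. c k * \<phi> k)"
  have [measurable]: "S \<in> borel_measurable M"
    unfolding S_def using K by (intro borel_measurable_sum) auto
  have [measurable]: "B t \<in> borel_measurable M" using t by simp
  have iSt: "integrable M (\<lambda>\<omega>. S \<omega> * B t \<omega>)"
    unfolding S_def sum_distrib_right mult.assoc using gi(3) K t by (intro Bochner_Integration.integrable_sum) auto
  have itt: "integrable M (\<lambda>\<omega>. B t \<omega> * B t \<omega>)" using gi(3) t by simp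
  have "expectation (\<lambda>\<omega>. S \<omega> * B t \<omega>) = (\<Sum>k\<in>K. c k * expectation (\<lambda>\<omega>. B k \<omega> * B t \<omega>))"
    unfolding S_def sum_distrib_right mult.assoc using gi(3) K t
    by (subst Bochner_Integration.integral_sum) auto
  also have "\<dots> = (\<Sum>k\<in>K. c k * (\<phi> k * v))"
    by (rule sum.cong) (use \<phi> var K in \<open>auto simp: v_def\<close>)
  also have "\<dots> = a * v" by (simp add: a_def sum_distrib_right mult.assoc)
  finally have cov: "expectation (\<lambda>\<omega>. S \<omega> * B t \<omega>) = a * v" .
  have iSS: "integrable M (\<lambda>\<omega>. (S \<omega>)\<^sup>2)" unfolding S_def by (rule gp(1)[OF _ K])
  have chS: "(CLINT \<omega>|M. iexp (S \<omega>)) = exp (- (expectation (\<lambda>\<omega>. (S \<omega>)\<^sup>2) / 2))"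
    unfolding S_def by (rule gp(2)[OF _ K])
  \<comment> \<open>The residual is itself a finite linear combination of the process, hence
    Gaussian. The two conditionals cover t in K and t outside K alike.\<close>
  have R: "S \<omega> - a * B t \<omega> = (\<Sum>k\<in>insert t K. ((if k \<in> K then c k else 0) - (if k = t then a else 0)) * B k \<omega>)" for \<omega>
  proof -
    have "(\<Sum>k\<in>insert t K. (if k \<in> K then c k else 0) * B k \<omega>) = S \<omega>"
      unfolding S_def using K by (intro sum.mono_neutral_cong_right) auto
    moreover have "(\<Sum>k\<in>insert t K. (if k = t then a else 0) * B k \<omega>) = a * B t \<omega>"
      using K by (simp add: if_distrib[where f="\<lambda>x. x * _"] sum.delta' cong: if_cong)
    ultimately show ?thesis by (simp add: left_diff_distrib sum_subtractf)
  qed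
  have "(CLINT \<omega>|M. iexp (S \<omega> - a * B t \<omega>)) = exp (- (expectation (\<lambda>\<omega>. (S \<omega> - a * B t \<omega>)\<^sup>2) / 2))"
    unfolding R by (rule gp(2)) (use K t in auto)
  also have "expectation (\<lambda>\<omega>. (S \<omega> - a * B t \<omega>)\<^sup>2)
      = expectation (\<lambda>\<omega>. (S \<omega>)\<^sup>2 - 2 * a * (S \<omega> * B t \<omega>) + a\<^sup>2 * (B t \<omega> * B t \<omega>))"
    by (simp add: power2_eq_square algebra_simps)
  also have "\<dots> = expectation (\<lambda>\<omega>. (S \<omega>)\<^sup>2) - a\<^sup>2 * v"
    using iSS iSt itt by (simp add: cov v_def[symmetric] power2_eq_square)
  finally have ch1: "(CLINT \<omega>|M. iexp (S \<omega> - a * B t \<omega>)) = exp (- ((expectation (\<lambda>\<omega>. (S \<omega>)\<^sup>2) - a\<^sup>2 * v) / 2))" .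
  have ch2: "(CLINT \<omega>|M. iexp (a * B t \<omega>)) = exp (- (a\<^sup>2 * v / 2))"
    using gp(2)[of "{t}" "\<lambda>_. a"] t by (simp add: power_mult_distrib v_def power2_eq_square mult_ac)
  have i1: "integrable M (\<lambda>\<omega>. iexp (f \<omega>))" if "f \<in> borel_measurable M" for f
    using that by (intro integrable_const_bound[where B=1]) auto
  have "(CLINT p|M \<Otimes>\<^sub>M M. iexp (\<Sum>k\<in>K. c k * (B k (fst p) + (B t (snd p) - B t (fst p)) * \<phi> k)))
      = (CLINT p|M \<Otimes>\<^sub>M M. iexp (S (fst p) - a * B t (fst p)) * iexp (a * B t (snd p)))"
    by (intro Bochner_Integration.integral_cong)
       (auto simp: S_def a_def sum_distrib_left sum_distrib_right sum.distrib sum_subtractf exp_add[symmetric] algebra_simps)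
  also have "\<dots> = (CLINT \<omega>|M. iexp (S \<omega> - a * B t \<omega>)) * (CLINT \<omega>|M. iexp (a * B t \<omega>))"
    using MM.integral_fst'[of "\<lambda>p. iexp (S (fst p) - a * B t (fst p)) * iexp (a * B t (snd p))"]
    by (subst MM.integral_fst'[symmetric]) (auto intro!: MM.integrable_const_bound[where B=1] simp: norm_mult)
  \<comment> \<open>The variances of the two factors, E S^2 - a^2 * v and a^2 * v, add up to E
    S^2.\<close>
  also have "\<dots> = (CLINT \<omega>|M. iexp (S \<omega>))"
    unfolding ch1 ch2 chS by (simp add: exp_add[symmetric] of_real_exp[symmetric] of_real_mult[symmetric] diff_divide_distrib
          del: of_real_exp of_real_mult)
  finally show "(CLINT \<omega>|M. iexp (\<Sum>k\<in>K. c k * B k \<omega>))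
      = (CLINT p|M \<Otimes>\<^sub>M M. iexp (\<Sum>k\<in>K. c k * (B k (fst p) + (B t (snd p) - B t (fst p)) * \<phi> k)))"
    by (simp add: S_def)
qed

section \<open>Absolute continuity\<close>

lemma measurable_reflected_euler:
  assumes b: "continuous_on UNIV b" and w: "\<And>k. k \<le> n \<Longrightarrow> (\<lambda>x. w x (real k * h)) \<in> borel_measurable N"
  shows "(\<lambda>x. reflected_euler b y0 h (w x) n) \<in> borel_measurable N"
  using w
proof (induction n)
  case (Suc n)
  have [measurable]: "(\<lambda>x. reflected_euler b y0 h (w x) n) \<in> borel_measurable N"
    using Suc by simp
  have [measurable]: "b \<in> borel_measurable borel"
    using b by (rule borel_measurable_continuous_onI)
  have [measurable]: "(\<lambda>x. w x (real (Suc n) * h)) \<in> borel_measurable N" "(\<lambda>x. w x (real n * h)) \<in> borel_measurable N"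
    using Suc.prems[of "Suc n"] Suc.prems[of n] by (simp_all del: of_nat_Suc)
  show ?case by (simp del: of_nat_Suc)
qed simp

text \<open>At a point mass the second moment is the square of the mean, so \<open>nondeg\<close>
  leaves only the laws with a Lebesgue density.\<close>

lemma emeasure_gaussian_negligible:
  assumes X: "gaussian_rv M X" and nondeg: "(\<integral>\<omega>. (X \<omega>)\<^sup>2 \<partial>M) \<noteq> (\<integral>\<omega>. X \<omega> \<partial>M)\<^sup>2"
    and M: "prob_space M" and S: "S \<in> sets borel" "negligible S"
  shows "emeasure M (X -` S \<inter> space M) = 0"
proof -
  interpret prob_space M by fact
  have [measurable]: "X \<in> borel_measurable M" using X by (simp add: gaussian_rv_def)
  have "distr M borel X \<noteq> return borel \<mu>" for \<mu>
  proof
    assume eq: "distr M borel X = return borel \<mu>"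
    have "(\<integral>\<omega>. X \<omega> \<partial>M) = (\<integral>x. x \<partial>distr M borel X)"
      by (subst integral_distr) auto
    moreover have "(\<integral>\<omega>. (X \<omega>)\<^sup>2 \<partial>M) = (\<integral>x. x\<^sup>2 \<partial>distr M borel X)"
      by (subst integral_distr) auto
    ultimately show False using nondeg by (simp add: eq integral_return)
  qed
  then obtain \<mu> \<sigma> where D: "distributed M lborel X (\<lambda>x. ennreal (normal_density \<mu> \<sigma> x))"
    using X by (auto simp: gaussian_rv_def)
  have S0: "S \<in> null_sets lborel"
    using S by (simp add: negligible_iff_null_sets null_sets_completion_iff)
  have "emeasure M (X -` S \<inter> space M) = (\<integral>\<^sup>+x. ennreal (normal_density \<mu> \<sigma> x) * indicator S x \<partial>lborel)"
    using distributed_emeasure[OF D] S by simp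
  also have "\<dots> = 0" by (rule nn_integral_null_set[OF S0])
  finally show ?thesis .
qed

text \<open>On [0, t] the power of s grows with s while that of |s - t| decreases; strictness comes
  from the former.\<close>

lemma fbm_covariance_weight:
  fixes H t :: real
  assumes H: "0 < H" and t: "0 < t"
  defines "\<phi> \<equiv> \<lambda>s. (s powr (2 * H) + t powr (2 * H) - \<bar>s - t\<bar> powr (2 * H)) / 2 / t powr (2 * H)"
  shows "continuous_on {0..t} \<phi>" and "mono_on {0..t} \<phi>" and "\<And>s. 0 \<le> s \<Longrightarrow> s < t \<Longrightarrow> \<phi> s < \<phi> t"
proof -
  show "continuous_on {0..t} \<phi>"
    unfolding \<phi>_def using H t
    by (intro continuous_on_divide continuous_on_diff continuous_on_add continuous_on_powr'
          continuous_on_rabs continuous_on_const continuous_on_id) auto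
  show "mono_on {0..t} \<phi>"
  proof (rule mono_onI)
    fix r s assume rs: "r \<in> {0..t}" "s \<in> {0..t}" "r \<le> s"
    have "r powr (2 * H) \<le> s powr (2 * H)" "\<bar>s - t\<bar> powr (2 * H) \<le> \<bar>r - t\<bar> powr (2 * H)"
      using rs H by (auto intro!: powr_mono2)
    then show "\<phi> r \<le> \<phi> s" unfolding \<phi>_def by (intro divide_right_mono) auto
  qed
  show "\<phi> s < \<phi> t" if "0 \<le> s" "s < t" for s
  proof -
    have "s powr (2 * H) < t powr (2 * H)" using that H by (intro powr_less_mono2) auto
    moreover have "0 \<le> \<bar>s - t\<bar> powr (2 * H)" "\<bar>t - t\<bar> powr (2 * H) = 0" by auto
    ultimately have "s powr (2 * H) + t powr (2 * H) - \<bar>s - t\<bar> powr (2 * H)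
        < t powr (2 * H) + t powr (2 * H) - \<bar>t - t\<bar> powr (2 * H)" by linarith
    then show ?thesis unfolding \<phi>_def using t by (intro divide_strict_right_mono) auto
  qed
qed

text \<open>Fubini is applied to the resampled pair: the first component freezes the residual path,
  the second supplies the Gaussian parameter. Equality of laws leads back to B, and only there does
  the solution enter, as the limit of the scheme.\<close>

lemma reflected_sde_avoids_negligible:
  fixes M :: "'a measure" and B Y K :: "real \<Rightarrow> 'a \<Rightarrow> real"
  assumes M: "prob_space M" and H: "0 < H"
    and fbm: "fractional_brownian_motion M H B"
    and b: "b \<in> C1_bounded" and y0: "0 \<le> y0"
    and sol: "solves_skorokhod_problem M b y0 B Y K" and t: "0 < t"
    and A: "A \<in> sets borel" "negligible A" "A \<subseteq> {0<..}"
  shows "AE \<omega> in M. Y t \<omega> \<notin> A"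
proof -
  interpret prob_space M by fact
  interpret MM: pair_prob_space M M ..
  have gauss: "gaussian_process M B" and mean: "\<And>s. 0 \<le> s \<Longrightarrow> expectation (B s) = 0"
    and cov: "\<And>s r. 0 \<le> s \<Longrightarrow> 0 \<le> r \<Longrightarrow> expectation (\<lambda>\<omega>. B s \<omega> * B r \<omega>)
        = (s powr (2 * H) + r powr (2 * H) - \<bar>s - r\<bar> powr (2 * H)) / 2"
    and cont: "AE \<omega> in M. continuous_on {0..} (\<lambda>s. B s \<omega>)"
    using fbm by (auto simp: fractional_brownian_motion_def)
  have Bm: "B s \<in> borel_measurable M" if "0 \<le> s" for s
    using centred_gaussian_process_integrable(1)[OF gauss mean] that by simp
  obtain L where L: "L-lipschitz_on UNIV b" using C1_bounded_lipschitz[OF b] .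
  have bc: "continuous_on UNIV b" using L by (rule lipschitz_on_continuous_on)
  have var: "expectation (\<lambda>\<omega>. B t \<omega> * B t \<omega>) = t powr (2 * H)"
    using cov[of t t] t by simp
  define \<phi> where "\<phi> s = (s powr (2 * H) + t powr (2 * H) - \<bar>s - t\<bar> powr (2 * H)) / 2 / t powr (2 * H)" for s
  note \<phi> = fbm_covariance_weight[OF H t, folded \<phi>_def]
  define e where "e n w = reflected_euler b y0 (t / real (Suc n)) w (Suc n)" for w n
  let ?\<Pi> = "\<Pi>\<^sub>M s\<in>{0..}. (borel :: real measure)"
  \<comment> \<open>For real sequences \<open>Cauchy\<close> is the same as convergence. It keeps
    out divergent sequences, on which \<open>lim\<close> is an arbitrary value.\<close>
  define E where "E = {v \<in> space ?\<Pi>. Cauchy (\<lambda>n. e n v) \<and> lim (\<lambda>n. e n v) \<in> A}"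
  have e_cong: "e n w = e n w'" if "\<And>s. 0 \<le> s \<Longrightarrow> w s = w' s" for w w' n
    unfolding e_def by (rule reflected_euler_cong) (use that t in auto)
  have e_meas: "(\<lambda>x. e n (w x)) \<in> borel_measurable N"
    if "\<And>s. 0 \<le> s \<Longrightarrow> (\<lambda>x. w x s) \<in> borel_measurable N" for w n and N :: "'c measure"
    unfolding e_def by (rule measurable_reflected_euler[OF bc]) (use that t in simp)
  have limit_set: "{x \<in> space N. Cauchy (\<lambda>n. f n x) \<and> lim (\<lambda>n. f n x) \<in> A} \<in> sets N"
    if f: "\<And>n. f n \<in> borel_measurable N" for f :: "nat \<Rightarrow> 'c \<Rightarrow> real" and N
  proof -
    have "{x \<in> space N. Cauchy (\<lambda>n. f n x)} \<inter> ((\<lambda>x. lim (\<lambda>n. f n x)) -` A \<inter> space N) \<in> sets N"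
      by (intro sets.Int sets_Collect_Cauchy f measurable_sets[OF borel_measurable_lim_metric A(1)])
    also have "{x \<in> space N. Cauchy (\<lambda>n. f n x)} \<inter> ((\<lambda>x. lim (\<lambda>n. f n x)) -` A \<inter> space N)
        = {x \<in> space N. Cauchy (\<lambda>n. f n x) \<and> lim (\<lambda>n. f n x) \<in> A}" by auto
    finally show ?thesis .
  qed
  have E: "E \<in> sets ?\<Pi>" unfolding E_def by (intro limit_set e_meas) simp
  define V where "V \<omega> = (\<lambda>s\<in>{0..}. B s \<omega>)" for \<omega>
  define W where "W p = (\<lambda>s\<in>{0..}. B s (fst p) + (B t (snd p) - B t (fst p)) * \<phi> s)" for p
  have V: "V \<in> measurable M ?\<Pi>"
    unfolding V_def by (intro measurable_restrict) (simp add: Bm)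
  have W: "W \<in> measurable (M \<Otimes>\<^sub>M M) ?\<Pi>"
    unfolding W_def using t
    by (intro measurable_restrict borel_measurable_add borel_measurable_diff borel_measurable_times
          borel_measurable_const measurable_compose[OF measurable_fst] measurable_compose[OF measurable_snd])
       (auto intro: Bm)
  have law: "distr M ?\<Pi> V = distr (M \<Otimes>\<^sub>M M) ?\<Pi> W"
    unfolding V_def W_def
    by (rule gaussian_process_resample[OF gauss mean]) (use t in \<open>simp_all add: var cov \<phi>_def\<close>)
  \<comment> \<open>For fixed \<omega> the path is affine in x = B t \<omega>', and the exceptional
    x form a Borel null set, which a nondegenerate Gaussian variable avoids.\<close>
  have null: "AE \<omega>' in M. W (\<omega>, \<omega>') \<notin> E" if c: "continuous_on {0..} (\<lambda>s. B s \<omega>)" for \<omega>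
  proof -
    define w where "w s = B s \<omega> - B t \<omega> * \<phi> s" for s
    define S where "S = {x. Cauchy (\<lambda>n. e n (\<lambda>s. w s + x * \<phi> s)) \<and> lim (\<lambda>n. e n (\<lambda>s. w s + x * \<phi> s)) \<in> A}"
    have "(\<lambda>x. e n (\<lambda>s. w s + x * \<phi> s)) \<in> borel_measurable borel" for n
      by (rule e_meas) simp
    from limit_set[OF this] have "S \<in> sets borel" by (simp add: S_def)
    moreover have "negligible S"
      unfolding S_def e_def Cauchy_convergent_iff
    proof (rule negligible_reflected_euler_limit[OF b y0 t _ \<phi>(1,2) _ A(2,3)])
      show "continuous_on {0..t} w"
        unfolding w_def by (intro continuous_intros \<phi>(1) continuous_on_subset[OF c]) auto
    qed (rule \<phi>(3))
    ultimately have "emeasure M (B t -` S \<inter> space M) = 0"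
      using gauss[unfolded gaussian_process_def, rule_format, of "{t}" "\<lambda>_. 1"] t var mean[of t]
      by (intro emeasure_gaussian_negligible) (auto simp: power2_eq_square prob_space_axioms)
    then have "AE \<omega>' in M. \<omega>' \<notin> B t -` S \<inter> space M"
      using \<open>S \<in> sets borel\<close> Bm[of t] t by (intro AE_not_in) (auto intro!: null_setsI)
    with AE_space show ?thesis
    proof eventually_elim
      case (elim \<omega>')
      have "e n (W (\<omega>, \<omega>')) = e n (\<lambda>s. w s + B t \<omega>' * \<phi> s)" for n
        by (rule e_cong) (simp add: W_def w_def algebra_simps)
      with elim show ?case by (auto simp: E_def S_def)
    qed
  qed
  have "AE p in M \<Otimes>\<^sub>M M. W p \<notin> E"
  proof (rule MM.AE_pair_measure)
    show "{p \<in> space (M \<Otimes>\<^sub>M M). W p \<notin> E} \<in> sets (M \<Otimes>\<^sub>M M)"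
      using W E by measurable
    show "AE \<omega> in M. AE \<omega>' in M. W (\<omega>, \<omega>') \<notin> E"
      using cont by eventually_elim (rule null)
  qed
  then have "AE v in distr (M \<Otimes>\<^sub>M M) ?\<Pi> W. v \<notin> E"
    using E by (subst AE_distr_iff[OF W]) auto
  then have VE: "AE \<omega> in M. V \<omega> \<notin> E"
    unfolding law[symmetric] by (rule AE_distrD[OF V])
  \<comment> \<open>The variance at time 0 is zero. The scheme starts at y0 whereas the equation
    starts at y0 + B 0, so its convergence to Y needs this.\<close>
  have B0: "AE \<omega> in M. B 0 \<omega> = 0"
  proof -
    have i: "integrable M (\<lambda>\<omega>. B 0 \<omega> * B 0 \<omega>)"
      using centred_gaussian_process_integrable(3)[OF gauss mean] by simp
    have "expectation (\<lambda>\<omega>. B 0 \<omega> * B 0 \<omega>) = 0" using cov[of 0 0] by simp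
    then show ?thesis using integral_nonneg_eq_0_iff_AE[OF i] by simp
  qed
  have "AE \<omega> in M. reflected_path b y0 (\<lambda>s. B s \<omega>) (\<lambda>s. Y s \<omega>) (\<lambda>s. K s \<omega>)"
    using sol by (simp add: solves_skorokhod_problem_def)
  with VE B0 AE_space show ?thesis
  proof eventually_elim
    case (elim \<omega>)
    \<comment> \<open>Along the true path the scheme converges to Y t, so a value of Y t in A would
      place the path in E.\<close>
    have "(\<lambda>n. e n (\<lambda>s. B s \<omega>)) \<longlonglongrightarrow> Y t \<omega>"
      unfolding e_def by (rule reflected_euler_tendsto[OF _ _ L t]) (use elim in auto)
    moreover have "e n (V \<omega>) = e n (\<lambda>s. B s \<omega>)" for n
      by (rule e_cong) (simp add: V_def)
    ultimately have "convergent (\<lambda>n. e n (V \<omega>))" "lim (\<lambda>n. e n (V \<omega>)) = Y t \<omega>"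
      by (auto intro: convergentI limI)
    moreover have "V \<omega> \<in> space ?\<Pi>" using V elim by (auto dest: measurable_space)
    ultimately show ?case using elim by (auto simp: E_def Cauchy_convergent_iff)
  qed
qed

theorem theorem2p12:
  fixes M :: "'a measure" and B Y K :: "real \<Rightarrow> 'a \<Rightarrow> real"
    and H y0 t :: real and b :: "real \<Rightarrow> real"
  assumes "prob_space M" and "complete_measure M"
    and "1 / 2 \<le> H" and "H < 1"
    and "fractional_brownian_motion M H B"
    and "b \<in> C1_bounded"
    and "0 \<le> y0"
    and "solves_skorokhod_problem M b y0 B Y K"
    and "0 < t"
  shows "\<exists>f :: real \<Rightarrow> ennreal. f \<in> borel_measurable lborel \<and>
    distr (density M (indicator {\<omega> \<in> space M. 0 < Y t \<omega>})) borel (Y t) = density lborel f"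
proof -
  let ?P = "{\<omega> \<in> space M. 0 < Y t \<omega>}"
  let ?N = "distr (density M (indicator ?P)) borel (Y t)"
  have Y[measurable]: "Y t \<in> borel_measurable M"
    using assms by (simp add: solves_skorokhod_problem_def)
  have "absolutely_continuous lborel ?N"
    unfolding absolutely_continuous_def
  proof
    fix A :: "real set" assume A: "A \<in> null_sets lborel"
    then have [measurable]: "A \<in> sets borel" by auto
    \<comment> \<open>The restricted law does not see the nonpositive part of A, and the path
      argument covers null sets in the positive half-line.\<close>
    have "negligible (A \<inter> {0<..})"
      by (rule negligible_subset[of A]) (use A in \<open>auto simp: negligible_iff_null_sets null_sets_completionI\<close>)
    then have ae: "AE \<omega> in M. Y t \<omega> \<notin> A \<inter> {0<..}"
      using assms by (intro reflected_sde_avoids_negligible[of M H B b y0 Y K t]) auto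
    have "emeasure ?N A = emeasure (density M (indicator ?P)) (Y t -` A \<inter> space M)"
      by (subst emeasure_distr) auto
    also have "\<dots> = (\<integral>\<^sup>+\<omega>. indicator ?P \<omega> * indicator (Y t -` A \<inter> space M) \<omega> \<partial>M)"
      by (subst emeasure_density) auto
    also have "\<dots> = (\<integral>\<^sup>+\<omega>. 0 \<partial>M)"
      by (rule nn_integral_cong_AE) (use ae in eventually_elim, auto simp: indicator_def)
    finally show "A \<in> null_sets ?N" by (auto intro!: null_setsI)
  qed
  then obtain f where "f \<in> borel_measurable lborel" "density lborel f = ?N"
    using sigma_finite_measure.Radon_Nikodym[OF sigma_finite_lborel, of ?N] by auto
  then show ?thesis by (intro exI[of _ f]) auto
qed

end
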